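(* Let $\mathcal{A}$ and $\mathcal{B}$ be presentations of a transversal matroid $M$ on $E$. The sublattice $L_{\mathcal{A},\mathcal{B}}$ of $L_\mathcal{A}$ consists exactly of the sets $I\in L_\mathcal{A}$ satisfying condition $( * )$, together with all intersections of such sets, where $( * )$: $I=s_\mathcal{A}(X)$ for some $X\subseteq E$ with $|s_\mathcal{A}(X)|=r(X)=|s_\mathcal{B}(X)|$. Moreover, the sets $I$ satisfying $( * )$ correspond to the principal extensions $M+_X x$ of $M$ that are common to $T_\mathcal{A}$ and $T_\mathcal{B}$: for $X$ as in $( * )$, $M[\mathcal{A}^{s_\mathcal{A}(X)}]=M[\mathcal{B}^{s_\mathcal{B}(X)}]=M+_X x$.
   Context: Let $r=r(M)$, $[r]=\{1,\dots,r\}$, and let $r(\cdot)$ also denote the rank function of $M$. For a set system $\mathcal{A}=(A_i:i\in[r])$ on a finite set $E$, $M[\mathcal{A}]$ is the transversal matroid on $E$ whose independent sets are the partial transversals of $\mathcal{A}$; $\mathcal{A}$ is a presentation of $M[\mathcal{A}]$, with exactly $r$ sets. $s_\mathcal{A}(X)=\{i: X\cap A_i\neq\emptyset\}$. Fix $x\notin E$; for $I\subseteq[r]$, $\mathcal{A}^I$ is obtained from $\mathcal{A}$ by replacing $A_i$ by $A_i\cup\{x\}$ for each $i\in I$. Let $\sigma_\mathcal{A}(I)=I\cup\{k\in[r]-I: x\text{ is a coloop of } M[\mathcal{A}^I]\backslash A_k\}$; $L_\mathcal{A}$ is the set of $I\subseteq[r]$ with $\sigma_\mathcal{A}(I)=I$;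 $T_\mathcal{A}=\{M[\mathcal{A}^I]:I\in L_\mathcal{A}\}$; similarly for $\mathcal{B}$. $L_{\mathcal{A},\mathcal{B}}=\{I\in L_\mathcal{A}: M[\mathcal{A}^I]=M[\mathcal{B}^J]\text{ for some }J\in L_\mathcal{B}\}$. For $Y\subseteq E$, the principal extension $M+_Y x$ is the matroid on $E\cup\{x\}$ with rank function $r'(Z)=r(Z)$ and $r'(Z\cup\{x\})=r(Z)$ if $Y\subseteq \mathrm{cl}_M(Z)$, and $r(Z)+1$ otherwise, for $Z\subseteq E$. *)

theory Defs
  imports Main
begin

text \<open>
  A matroid is recorded by its ground set and its collection of independent sets. The independence
  axioms are not part of the type: every structure below is either of the form \<open>M[\<A>]\<close>
  for a set system on a finite set, or a deletion or principal extension of such a structure.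
\<close>

datatype 'a matroid = Matroid (ground: "'a set") (indep: "'a set set")

definition rank :: "'a matroid \<Rightarrow> 'a set \<Rightarrow> nat" where
  "rank M Z = Max {card I | I. I \<subseteq> Z \<and> I \<in> indep M}"

abbreviation full_rank :: "'a matroid \<Rightarrow> nat" where
  "full_rank M \<equiv> rank M (ground M)"

definition closure :: "'a matroid \<Rightarrow> 'a set \<Rightarrow> 'a set" where
  "closure M Z = {e \<in> ground M. rank M (insert e Z) = rank M Z}"

definition basis :: "'a matroid \<Rightarrow> 'a set \<Rightarrow> bool" where
  "basis M B \<longleftrightarrow> B \<in> indep M \<and> (\<forall>I \<in> indep M. B \<subseteq> I \<longrightarrow> I = B)"

definition coloop :: "'a matroid \<Rightarrow> 'a \<Rightarrow> bool" where
  "coloop M e \<longleftrightarrow> e \<in> ground M \<and> (\<forall>B. basis M B \<longrightarrow> e \<in> B)"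

definition delete :: "'a matroid \<Rightarrow> 'a set \<Rightarrow> 'a matroid" where
  "delete M D = Matroid (ground M - D) {I \<in> indep M. I \<subseteq> ground M - D}"

definition principal_ext_rank :: "'a matroid \<Rightarrow> 'a set \<Rightarrow> 'a \<Rightarrow> 'a set \<Rightarrow> nat" where
  "principal_ext_rank M Y x W =
     (if x \<in> W
      then (if Y \<subseteq> closure M (W - {x}) then rank M (W - {x}) else rank M (W - {x}) + 1)
      else rank M W)"

text \<open>
  The principal extension \<open>M +\<^sub>Y x\<close> is the matroid on \<open>E \<union> {x}\<close> with the above rank function;
  its independent sets are the sets whose rank equals their cardinality.
\<close>

definition principal_extension :: "'a matroid \<Rightarrow> 'a set \<Rightarrow> 'a \<Rightarrow> 'a matroid" where
  "principal_extension M Y x =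
     Matroid (insert x (ground M))
       {W. W \<subseteq> insert x (ground M) \<and> principal_ext_rank M Y x W = card W}"

definition partial_transversal :: "nat \<Rightarrow> (nat \<Rightarrow> 'a set) \<Rightarrow> 'a set \<Rightarrow> bool" where
  "partial_transversal r A Z \<longleftrightarrow>
     (\<exists>f. inj_on f Z \<and> (\<forall>z \<in> Z. f z \<in> {1..r} \<and> z \<in> A (f z)))"

definition transversal_matroid :: "'a set \<Rightarrow> nat \<Rightarrow> (nat \<Rightarrow> 'a set) \<Rightarrow> 'a matroid" where
  "transversal_matroid E r A = Matroid E {Z. Z \<subseteq> E \<and> partial_transversal r A Z}"

text \<open>
  A set system \<open>(A\<^sub>i : i \<in> [r])\<close> is a function on the naturals of which only the values on
  \<open>{1..r}\<close> matter; a presentation of \<open>M\<close> has exactly \<open>r = r(M)\<close> sets.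
\<close>

definition presentation :: "'a matroid \<Rightarrow> (nat \<Rightarrow> 'a set) \<Rightarrow> bool" where
  "presentation M A \<longleftrightarrow>
     (\<forall>i \<in> {1..full_rank M}. A i \<subseteq> ground M) \<and>
     M = transversal_matroid (ground M) (full_rank M) A"

definition supp :: "'a matroid \<Rightarrow> (nat \<Rightarrow> 'a set) \<Rightarrow> 'a set \<Rightarrow> nat set" where
  "supp M A X = {i \<in> {1..full_rank M}. X \<inter> A i \<noteq> {}}"

definition extend_system :: "(nat \<Rightarrow> 'a set) \<Rightarrow> 'a \<Rightarrow> nat set \<Rightarrow> nat \<Rightarrow> 'a set" where
  "extend_system A x I = (\<lambda>i. if i \<in> I then insert x (A i) else A i)"

text \<open>For a presentation \<open>\<A>\<close> of \<open>M\<close> on \<open>E\<close>, this is the matroid \<open>M[\<A>\<^sup>I]\<close> on \<open>E \<union> {x}\<close>.\<close>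

definition ext_matroid ::
  "'a matroid \<Rightarrow> (nat \<Rightarrow> 'a set) \<Rightarrow> 'a \<Rightarrow> nat set \<Rightarrow> 'a matroid" where
  "ext_matroid M A x I =
     transversal_matroid (insert x (ground M)) (full_rank M) (extend_system A x I)"

definition sigma :: "'a matroid \<Rightarrow> (nat \<Rightarrow> 'a set) \<Rightarrow> 'a \<Rightarrow> nat set \<Rightarrow> nat set" where
  "sigma M A x I =
     I \<union> {k \<in> {1..full_rank M} - I. coloop (delete (ext_matroid M A x I) (A k)) x}"

definition L_sets :: "'a matroid \<Rightarrow> (nat \<Rightarrow> 'a set) \<Rightarrow> 'a \<Rightarrow> nat set set" where
  "L_sets M A x = {I. I \<subseteq> {1..full_rank M} \<and> sigma M A x I = I}"

definition T_exts :: "'a matroid \<Rightarrow> (nat \<Rightarrow> 'a set) \<Rightarrow> 'a \<Rightarrow> 'a matroid set" where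
  "T_exts M A x = {ext_matroid M A x I | I. I \<in> L_sets M A x}"

definition L_common ::
  "'a matroid \<Rightarrow> (nat \<Rightarrow> 'a set) \<Rightarrow> (nat \<Rightarrow> 'a set) \<Rightarrow> 'a \<Rightarrow> nat set set" where
  "L_common M A B x =
     {I \<in> L_sets M A x. \<exists>J \<in> L_sets M B x. ext_matroid M A x I = ext_matroid M B x J}"

definition tight :: "'a matroid \<Rightarrow> (nat \<Rightarrow> 'a set) \<Rightarrow> (nat \<Rightarrow> 'a set) \<Rightarrow> 'a set \<Rightarrow> bool" where
  "tight M A B X \<longleftrightarrow>
     X \<subseteq> ground M \<and> card (supp M A X) = rank M X \<and> rank M X = card (supp M B X)"

text \<open>Condition \<open>(*)\<close> on an index set \<open>I\<close>.\<close>

definition star :: "'a matroid \<Rightarrow> (nat \<Rightarrow> 'a set) \<Rightarrow> (nat \<Rightarrow> 'a set) \<Rightarrow> nat set \<Rightarrow> bool" where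
  "star M A B I \<longleftrightarrow> (\<exists>X. tight M A B X \<and> I = supp M A X)"

end

theory Submission
  imports Defs
begin

text \<open>
  Call an independent set \<open>Y\<close> tight if \<open>|s(Y)| = |Y|\<close>. By Hall's theorem, for independent
  \<open>Z\<close> the set \<open>Z \<union> {x}\<close> is dependent in \<open>M[\<A>\<^sup>I]\<close> iff \<open>I \<subseteq> s(Y)\<close> for some tight \<open>Y \<subseteq> Z\<close>.
  Hence \<open>\<sigma>\<close> is the closure operator generated by the supports of tight sets, and since these
  are closed under union, \<open>L\<close> is a lattice of sets.

  If \<open>M[\<A>\<^sup>I] = M[\<B>\<^sup>J]\<close>, the minimal independent sets spanning \<open>x\<close> are tight for both
  presentations, and \<open>I\<close> is the intersection of their supports. Conversely, let \<open>X\<close> range over a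
  family of sets that are tight for both. The ranks of the systems obtained by deleting the indices
  in \<open>s(X)\<close> are those of the contraction \<open>M/X\<close>, so they agree for \<open>\<A>\<close> and \<open>\<B>\<close>; submodularity
  in the set of indices carries this agreement over to the intersection of the supports, and
  agreement of these ranks determines the extension.
\<close>

section \<open>Hall's theorem and the rank function of a set system\<close>

text \<open>The index set is a parameter, unlike in \<open>supp\<close>, because the proof
  constantly deletes indices and compares the subsystems that remain.\<close>

definition hits :: "(nat \<Rightarrow> 'a set) \<Rightarrow> nat set \<Rightarrow> 'a set \<Rightarrow> nat set" where
  "hits A C V = {i \<in> C. V \<inter> A i \<noteq> {}}"

definition matchable :: "(nat \<Rightarrow> 'a set) \<Rightarrow> nat set \<Rightarrow> 'a set \<Rightarrow> bool" where
  "matchable A C Z \<longleftrightarrow> (\<exists>f. inj_on f Z \<and> (\<forall>z \<in> Z. f z \<in> C \<and> z \<in> A (f z)))"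

lemma finite_hits: "finite C \<Longrightarrow> finite (hits A C V)"
  by (simp add: hits_def)

lemma hits_subset: "hits A C V \<subseteq> C"
  by (auto simp: hits_def)

lemma hits_mono: "V \<subseteq> W \<Longrightarrow> hits A C V \<subseteq> hits A C W"
  by (auto simp: hits_def)

lemma hits_Un: "hits A C (V \<union> W) = hits A C V \<union> hits A C W"
  by (auto simp: hits_def)

lemma hits_empty [simp]: "hits A C {} = {}"
  by (simp add: hits_def)

text \<open>Each element is counted on the left at most as often as on the right. The submodular
  inequalities below are obtained by counting with this lemma.\<close>

lemma card_add_le_card_add:
  assumes "finite S" "finite T" "P \<union> Q \<subseteq> S \<union> T" "P \<inter> Q \<subseteq> S \<inter> T"
  shows "card P + card Q \<le> card S + card T"
proof -
  have fin: "finite P" "finite Q"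
    using assms by (auto intro: finite_subset)
  have "card P + card Q = card (P \<union> Q) + card (P \<inter> Q)"
    using fin by (rule card_Un_Int)
  also have "\<dots> \<le> card (S \<union> T) + card (S \<inter> T)"
    using assms by (intro add_mono card_mono) auto
  also have "\<dots> = card S + card T"
    using card_Un_Int[OF assms(1,2)] by simp
  finally show ?thesis .
qed

lemma matchable_subset: "matchable A C Z \<Longrightarrow> Y \<subseteq> Z \<Longrightarrow> matchable A C Y"
  unfolding matchable_def by (metis inj_on_subset subsetD)

lemma matchable_Un:
  assumes "matchable A C V" "matchable A D W" "C \<inter> D = {}" "V \<inter> W = {}"
  shows "matchable A (C \<union> D) (V \<union> W)"
proof -
  obtain f where f: "inj_on f V" "\<forall>z\<in>V. f z \<in> C \<and> z \<in> A (f z)"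
    using assms(1) by (auto simp: matchable_def)
  obtain g where g: "inj_on g W" "\<forall>z\<in>W. g z \<in> D \<and> z \<in> A (g z)"
    using assms(2) by (auto simp: matchable_def)
  define h where "h z = (if z \<in> V then f z else g z)" for z
  have hV: "h z = f z" if "z \<in> V" for z using that by (simp add: h_def)
  have hW: "h z = g z" if "z \<in> W" for z using that assms(4) by (auto simp: h_def)
  have "inj_on h (V \<union> W)"
  proof (rule inj_onI)
    fix y z assume yz: "y \<in> V \<union> W" "z \<in> V \<union> W" "h y = h z"
    have "f a \<noteq> g b" if "a \<in> V" "b \<in> W" for a b
      using that f(2) g(2) assms(3) by (metis disjoint_iff)
    then have "y \<in> V \<longleftrightarrow> z \<in> V" using yz hV hW by (metis Un_iff)
    then show "y = z"
      using yz hV hW inj_onD[OF f(1), of y z] inj_onD[OF g(1), of y z] by (cases "y \<in> V") auto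
  qed
  moreover have "\<forall>z\<in>V \<union> W. h z \<in> C \<union> D \<and> z \<in> A (h z)"
    using f(2) g(2) hV hW by auto
  ultimately show ?thesis unfolding matchable_def by blast
qed

section \<open>Hall's theorem\<close>

lemma matchable_card_le:
  assumes "finite C" "matchable A C Z"
  shows "card Z \<le> card (hits A C Z)"
proof -
  obtain f where f: "inj_on f Z" "\<forall>z\<in>Z. f z \<in> C \<and> z \<in> A (f z)"
    using assms(2) by (auto simp: matchable_def)
  have "f ` Z \<subseteq> hits A C Z" using f(2) by (auto simp: hits_def)
  then show ?thesis
    using card_inj_on_le[OF f(1)] finite_hits[OF assms(1)] by blast
qed

text \<open>Induction on the size of \<open>Z\<close>, with \<open>C\<close> free since both cases
  shrink it. If some nonempty proper subset has exactly as many hits as elements, it is matched into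
  its own hits and the rest into the other indices. Otherwise one element may take any index
  available to it.\<close>

lemma hall_sufficient:
  assumes "finite Z" "finite C" "\<And>V. V \<subseteq> Z \<Longrightarrow> card V \<le> card (hits A C V)"
  shows "matchable A C Z"
  using assms
proof (induction "card Z" arbitrary: Z C rule: less_induct)
  case less
  show ?case
  proof (cases "Z = {}")
    case True
    then show ?thesis by (simp add: matchable_def)
  next
    case nonempty: False
    show ?thesis
    proof (cases "\<exists>V. V \<noteq> {} \<and> V \<subset> Z \<and> card (hits A C V) = card V")
      case True
      then obtain V where V: "V \<noteq> {}" "V \<subset> Z" "card (hits A C V) = card V" by blast
      let ?S = "hits A C V"
      have finV: "finite V" using V(2) less.prems(1) finite_subset by blast
      have hall_V: "card W \<le> card (hits A ?S W)" if "W \<subseteq> V" for W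
      proof -
        have "hits A ?S W = hits A C W" using that by (auto simp: hits_def)
        then show ?thesis using less.prems(3)[of W] that V(2) by auto
      qed
      have m1: "matchable A ?S V"
        by (rule less.hyps[OF psubset_card_mono[OF less.prems(1) V(2)] finV
              finite_hits[OF less.prems(2)]]) (rule hall_V)
      have small: "card (Z - V) < card Z"
        using V less.prems(1) by (intro psubset_card_mono) auto
      \<comment> \<open>Hall's condition for \<open>W\<close> with the remaining indices is the one
        for \<open>W\<close> together with \<open>V\<close>, minus the equality for
        \<open>V\<close>.\<close>
      have hall_rest: "card W \<le> card (hits A (C - ?S) W)" if W: "W \<subseteq> Z - V" for W
      proof -
        have eq: "hits A C (W \<union> V) = hits A (C - ?S) W \<union> ?S"
          by (auto simp: hits_def)
        have "card W + card V = card (W \<union> V)"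
          using W finV finite_subset[OF W] less.prems(1)
          by (intro card_Un_disjoint[symmetric]) auto
        also have "\<dots> \<le> card (hits A C (W \<union> V))"
          by (rule less.prems(3)) (use W V(2) in blast)
        also have "\<dots> = card (hits A (C - ?S) W) + card ?S"
          unfolding eq using less.prems(2)
          by (intro card_Un_disjoint) (auto simp: hits_def)
        finally show ?thesis using V(3) by simp
      qed
      have m2: "matchable A (C - ?S) (Z - V)"
        by (rule less.hyps[OF small _ _ hall_rest]) (simp_all add: less.prems)
      have "matchable A (?S \<union> (C - ?S)) (V \<union> (Z - V))"
        by (rule matchable_Un[OF m1 m2]) auto
      moreover have "?S \<union> (C - ?S) = C" "V \<union> (Z - V) = Z"
        using V(2) hits_subset[of A C V] by auto
      ultimately show ?thesis by simp
    next
      case strict: False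
      obtain z where z: "z \<in> Z" using nonempty by blast
      have "0 < card (hits A C {z})" using less.prems(3)[of "{z}"] z by simp
      then obtain i where i: "i \<in> C" "z \<in> A i" by (auto simp: card_gt_0_iff hits_def)
      \<comment> \<open>Every nonempty proper subset now has a surplus, which pays for the loss of
        the single index \<open>i\<close>.\<close>
      have hall_rest: "card W \<le> card (hits A (C - {i}) W)" if W: "W \<subseteq> Z - {z}" for W
      proof (cases "W = {}")
        case False
        have "W \<subset> Z" using W z by blast
        then have "card (hits A C W) \<noteq> card W" "card W \<le> card (hits A C W)"
          using False strict less.prems(3)[of W] by blast+
        then have "card W < card (hits A C W)" by simp
        moreover have "hits A (C - {i}) W = hits A C W - {i}" by (auto simp: hits_def)
        ultimately show ?thesis
          using card_Diff1_le[of "hits A C W" i]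
          by (cases "i \<in> hits A C W") (simp_all add: card_Diff_singleton)
      qed simp
      have m2: "matchable A (C - {i}) (Z - {z})"
        by (rule less.hyps[OF card_Diff1_less[OF less.prems(1) z] _ _ hall_rest])
          (simp_all add: less.prems)
      have m1: "matchable A {i} {z}" using i by (auto simp: matchable_def)
      have "matchable A ({i} \<union> (C - {i})) ({z} \<union> (Z - {z}))"
        by (rule matchable_Un[OF m1 m2]) auto
      moreover have "{i} \<union> (C - {i}) = C" "{z} \<union> (Z - {z}) = Z" using i z by auto
      ultimately show ?thesis by simp
    qed
  qed
qed

section \<open>The deficiency rank and its submodularity\<close>

text \<open>
  By the deficiency form of Hall's theorem this is the maximal size of a matching between the
  elements of \<open>Y\<close> and the indices in \<open>C\<close>. Taking the min-formula as the definition reduces all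
  submodularity arguments to counting.
\<close>

definition trank :: "(nat \<Rightarrow> 'a set) \<Rightarrow> nat set \<Rightarrow> 'a set \<Rightarrow> nat" where
  "trank A C Y = Min ((\<lambda>V. card (hits A C V) + card (Y - V)) ` Pow Y)"

lemma trank_le:
  assumes "finite Y" "V \<subseteq> Y"
  shows "trank A C Y \<le> card (hits A C V) + card (Y - V)"
  unfolding trank_def using assms by (intro Min_le) auto

lemma trank_attained:
  assumes "finite Y"
  obtains V where "V \<subseteq> Y" "trank A C Y = card (hits A C V) + card (Y - V)"
proof -
  have "trank A C Y \<in> (\<lambda>V. card (hits A C V) + card (Y - V)) ` Pow Y"
    unfolding trank_def using assms by (intro Min_in) auto
  then show thesis using that by auto
qed

lemma trank_le_card: "finite Y \<Longrightarrow> trank A C Y \<le> card Y"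
  using trank_le[of Y "{}" A C] by simp

lemma trank_le_card_hits: "finite Y \<Longrightarrow> trank A C Y \<le> card (hits A C Y)"
  using trank_le[of Y Y A C] by simp

text \<open>Indices and elements move in opposite directions: the intersection of two optimal sets
  is tested against the union of the index sets, and their union against the intersection. Equal
  index sets give submodularity in the elements, equal element sets submodularity in the
  indices.\<close>

lemma trank_bisubmodular:
  assumes "finite C1" "finite C2" "finite Y1" "finite Y2"
  shows "trank A (C1 \<union> C2) (Y1 \<inter> Y2) + trank A (C1 \<inter> C2) (Y1 \<union> Y2)
    \<le> trank A C1 Y1 + trank A C2 Y2"
proof -
  obtain V1 where V1: "V1 \<subseteq> Y1" "trank A C1 Y1 = card (hits A C1 V1) + card (Y1 - V1)"
    using trank_attained[OF assms(3)] .
  obtain V2 where V2: "V2 \<subseteq> Y2" "trank A C2 Y2 = card (hits A C2 V2) + card (Y2 - V2)"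
    using trank_attained[OF assms(4)] .
  have "card (hits A (C1 \<union> C2) (V1 \<inter> V2)) + card (hits A (C1 \<inter> C2) (V1 \<union> V2))
      \<le> card (hits A C1 V1) + card (hits A C2 V2)"
    using assms(1,2) by (intro card_add_le_card_add) (auto simp: hits_def)
  moreover have "card (Y1 \<inter> Y2 - V1 \<inter> V2) + card ((Y1 \<union> Y2) - (V1 \<union> V2))
      \<le> card (Y1 - V1) + card (Y2 - V2)"
    using assms(3,4) by (intro card_add_le_card_add) auto
  moreover have "trank A (C1 \<union> C2) (Y1 \<inter> Y2)
      \<le> card (hits A (C1 \<union> C2) (V1 \<inter> V2)) + card (Y1 \<inter> Y2 - V1 \<inter> V2)"
    using assms V1 V2 by (intro trank_le) auto
  moreover have "trank A (C1 \<inter> C2) (Y1 \<union> Y2)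
      \<le> card (hits A (C1 \<inter> C2) (V1 \<union> V2)) + card ((Y1 \<union> Y2) - (V1 \<union> V2))"
    using assms V1 V2 by (intro trank_le) auto
  ultimately show ?thesis using V1 V2 by linarith
qed

lemma trank_mono:
  assumes "finite C" "finite Y'" "Y \<subseteq> Y'"
  shows "trank A C Y \<le> trank A C Y'"
proof -
  obtain V where V: "V \<subseteq> Y'" "trank A C Y' = card (hits A C V) + card (Y' - V)"
    using trank_attained[OF assms(2)] .
  have "trank A C Y \<le> card (hits A C (V \<inter> Y)) + card (Y - V \<inter> Y)"
    using finite_subset[OF assms(3,2)] by (intro trank_le) auto
  also have "\<dots> \<le> card (hits A C V) + card (Y' - V)"
    using assms by (intro add_mono card_mono finite_hits hits_mono) auto
  finally show ?thesis using V by simp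
qed

lemma trank_le_add_card_elements:
  assumes "finite Y" "V \<subseteq> Y"
  shows "trank A C Y \<le> trank A C V + card (Y - V)"
proof -
  have finV: "finite V" using assms finite_subset by blast
  obtain W where W: "W \<subseteq> V" "trank A C V = card (hits A C W) + card (V - W)"
    using trank_attained[OF finV] .
  have "Y - W = (V - W) \<union> (Y - V)" using W assms by auto
  then have "card (Y - W) \<le> card (V - W) + card (Y - V)"
    by (simp add: card_Un_le)
  moreover have "trank A C Y \<le> card (hits A C W) + card (Y - W)"
    using W(1) assms by (intro trank_le) auto
  ultimately show ?thesis using W(2) by linarith
qed

lemma trank_le_add_card_indices:
  assumes "finite C" "finite Y" "D \<subseteq> C"
  shows "trank A C Y \<le> trank A D Y + card (C - D)"
proof -
  obtain W where W: "W \<subseteq> Y" "trank A D Y = card (hits A D W) + card (Y - W)"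
    using trank_attained[OF assms(2)] .
  have finD: "finite D" using assms(1,3) finite_subset by blast
  have "hits A C W \<subseteq> hits A D W \<union> (C - D)" by (auto simp: hits_def)
  then have "card (hits A C W) \<le> card (hits A D W \<union> (C - D))"
    using assms finD by (intro card_mono) (auto simp: finite_hits)
  also have "\<dots> \<le> card (hits A D W) + card (C - D)" by (rule card_Un_le)
  finally show ?thesis using trank_le[OF assms(2) W(1), of A C] W(2) by linarith
qed

lemma matchable_iff_trank:
  assumes "finite Z" "finite C"
  shows "matchable A C Z \<longleftrightarrow> trank A C Z = card Z"
proof
  assume m: "matchable A C Z"
  obtain V where V: "V \<subseteq> Z" "trank A C Z = card (hits A C V) + card (Z - V)"
    using trank_attained[OF assms(1)] .
  have "card V \<le> card (hits A C V)"
    using matchable_card_le[OF assms(2) matchable_subset[OF m V(1)]] .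
  moreover have "card Z = card V + card (Z - V)"
    using V(1) assms(1) by (simp add: card_Diff_subset card_mono finite_subset)
  ultimately show "trank A C Z = card Z"
    using V(2) trank_le_card[OF assms(1), of A C] by linarith
next
  assume t: "trank A C Z = card Z"
  show "matchable A C Z"
  proof (rule hall_sufficient[OF assms])
    fix V assume V: "V \<subseteq> Z"
    have "card Z = card V + card (Z - V)"
      using V(1) assms(1) by (simp add: card_Diff_subset card_mono finite_subset)
    then show "card V \<le> card (hits A C V)"
      using trank_le[OF assms(1) V, of A C] t by linarith
  qed
qed

lemma matchable_card_le_trank:
  assumes "finite Y" "finite C" "Z \<subseteq> Y" "matchable A C Z"
  shows "card Z \<le> trank A C Y"
  using matchable_iff_trank[of Z C A] trank_mono[of C Y Z A] assms finite_subset[OF assms(3,1)]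
  by simp

text \<open>The set is built greedily. By submodularity an element that raises the rank of
  \<open>Y\<close> also raises that of the smaller set \<open>Z\<close>, so
  \<open>insert e Z\<close> stays matchable.\<close>

lemma trank_basis:
  assumes "finite Y" "finite C"
  obtains Z where "Z \<subseteq> Y" "matchable A C Z" "card Z = trank A C Y"
proof -
  have "\<exists>Z\<subseteq>Y. matchable A C Z \<and> card Z = trank A C Y"
    using assms(1)
  proof (induction Y)
    case empty
    then show ?case using trank_le_card[of "{}" A C] by (simp add: matchable_def)
  next
    case (insert e Y)
    then obtain Z where Z: "Z \<subseteq> Y" "matchable A C Z" "card Z = trank A C Y" by blast
    have finZ: "finite Z" using Z(1) insert.hyps(1) finite_subset by blast
    show ?case
    proof (cases "trank A C (insert e Y) = trank A C Y")
      case True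
      then show ?thesis using Z by auto
    next
      case False
      have "trank A C Y \<le> trank A C (insert e Y)"
        using insert.hyps(1) assms(2) by (intro trank_mono) auto
      then have less: "trank A C Y < trank A C (insert e Y)" using False by simp
      have eq: "insert e Z \<inter> Y = Z" "insert e Z \<union> Y = insert e Y"
        using Z(1) insert.hyps(2) by auto
      have "trank A C Z + trank A C (insert e Y) \<le> trank A C (insert e Z) + trank A C Y"
        using trank_bisubmodular[of C C "insert e Z" Y A] assms(2) insert.hyps(1) finZ eq by simp
      moreover have "trank A C Z = card Z"
        using Z(2) matchable_iff_trank[OF finZ assms(2)] by blast
      moreover have "card (insert e Z) = card Z + 1"
        using finZ Z(1) insert.hyps(2) by (subst card_insert_disjoint) auto
      moreover have "trank A C (insert e Z) \<le> card (insert e Z)"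
        using finZ by (intro trank_le_card) simp
      moreover have "trank A C (insert e Y) \<le> trank A C Y + 1"
      proof -
        have "insert e Y - Y = {e}" using insert.hyps(2) by auto
        then show ?thesis
          using trank_le_add_card_elements[of "insert e Y" Y A C] insert.hyps(1)
          by (simp add: subset_insertI)
      qed
      ultimately have "trank A C (insert e Z) = card (insert e Z)"
        "card (insert e Z) = trank A C (insert e Y)"
        using less Z(3) by linarith+
      then show ?thesis
        using matchable_iff_trank[of "insert e Z" C A] finZ assms(2) Z(1)
        by (intro exI[of _ "insert e Z"]) auto
    qed
  qed
  then show thesis using that by blast
qed

text \<open>Submodularity passes from single elements that do not raise the rank to all of them
  together; this links the elementwise \<open>closure\<close> to ranks of unions.\<close>

lemma trank_Un_eq:
  assumes "finite X" "finite Y" "finite C" "\<And>e. e \<in> X \<Longrightarrow> trank A C (insert e Y) = trank A C Y"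
  shows "trank A C (Y \<union> X) = trank A C Y"
  using assms(1,4)
proof (induction X)
  case (insert e X)
  have "trank A C ((Y \<union> X) \<inter> insert e Y) + trank A C ((Y \<union> X) \<union> insert e Y)
      \<le> trank A C (Y \<union> X) + trank A C (insert e Y)"
    using trank_bisubmodular[of C C "Y \<union> X" "insert e Y" A] assms(2,3) insert.hyps(1) by simp
  moreover have "trank A C Y \<le> trank A C ((Y \<union> X) \<inter> insert e Y)"
    using assms(2,3) insert.hyps(1) by (intro trank_mono) auto
  moreover have "(Y \<union> X) \<union> insert e Y = Y \<union> insert e X" by auto
  moreover have "trank A C Y \<le> trank A C (Y \<union> insert e X)"
    using assms(2,3) insert.hyps(1) by (intro trank_mono) auto
  ultimately show ?case using insert by simp
qed simp

text \<open>Contracting a set whose rank is the size of its support amounts to deleting that support.\<close>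

lemma trank_contract:
  assumes fin: "finite X" "finite Y" "finite R" and C: "C \<subseteq> R"
    and tight: "trank A R X = card (hits A R X)"
  shows "trank A C (Y \<union> X) = trank A (C - hits A R X) Y + card (hits A R X \<inter> C)"
proof (rule antisym)
  let ?S = "hits A R X"
  have finC: "finite C" using fin(3) C finite_subset by blast
  obtain V where V: "V \<subseteq> Y" "trank A (C - ?S) Y = card (hits A (C - ?S) V) + card (Y - V)"
    using trank_attained[OF fin(2)] .
  \<comment> \<open>The witness for the bound is an optimal \<open>V\<close> enlarged by all of
    \<open>X\<close>, whose hits lie in the support anyway.\<close>
  have "hits A C (V \<union> X) \<subseteq> hits A (C - ?S) V \<union> (?S \<inter> C)"
    using C by (auto simp: hits_def)
  then have "card (hits A C (V \<union> X)) \<le> card (hits A (C - ?S) V \<union> (?S \<inter> C))"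
    using finC by (intro card_mono) (auto simp: finite_hits)
  also have "\<dots> \<le> card (hits A (C - ?S) V) + card (?S \<inter> C)" by (rule card_Un_le)
  finally have 1: "card (hits A C (V \<union> X)) \<le> card (hits A (C - ?S) V) + card (?S \<inter> C)" .
  have "card (Y \<union> X - (V \<union> X)) \<le> card (Y - V)"
    using fin by (intro card_mono) auto
  moreover have "trank A C (Y \<union> X) \<le> card (hits A C (V \<union> X)) + card (Y \<union> X - (V \<union> X))"
    using fin V by (intro trank_le) auto
  ultimately show "trank A C (Y \<union> X) \<le> trank A (C - ?S) Y + card (?S \<inter> C)"
    using 1 V by linarith
next
  let ?S = "hits A R X"
  have finC: "finite C" using fin(3) C finite_subset by blast
  have finYX: "finite (Y \<union> X)" using fin by simp
  obtain W where W: "W \<subseteq> Y \<union> X"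
      "trank A C (Y \<union> X) = card (hits A C W) + card (Y \<union> X - W)"
    using trank_attained[OF finYX] .
  \<comment> \<open>Adding \<open>X\<close> to the optimal \<open>W\<close> creates no hits outside
    \<open>?S\<close>. The elements of \<open>X - W\<close> are paid for by the min-formula for
    \<open>X\<close> itself, tested at \<open>X \<inter> W\<close>.\<close>
  have "trank A (C - ?S) Y \<le> card (hits A (C - ?S) ((W \<union> X) \<inter> Y)) + card (Y - (W \<union> X) \<inter> Y)"
    using fin by (intro trank_le) auto
  moreover have "card (hits A (C - ?S) ((W \<union> X) \<inter> Y)) \<le> card (hits A C W - ?S)"
    using C finC by (intro card_mono) (auto simp: hits_def)
  moreover have "card (Y - (W \<union> X) \<inter> Y) = card (Y - X - W)"
    by (rule arg_cong[where f = card]) auto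
  moreover have "card ?S \<le> card (hits A R (X \<inter> W)) + card (X - X \<inter> W)"
    using trank_le[OF fin(1), of "X \<inter> W" A R] tight by simp
  moreover have "card (X - X \<inter> W) = card (X - W)"
    by (rule arg_cong[where f = card]) auto
  moreover have "card (hits A R (X \<inter> W)) \<le> card (hits A C W \<inter> ?S) + card (?S - C)"
  proof -
    have "hits A R (X \<inter> W) \<subseteq> (hits A C W \<inter> ?S) \<union> (?S - C)" by (auto simp: hits_def)
    then have "card (hits A R (X \<inter> W)) \<le> card ((hits A C W \<inter> ?S) \<union> (?S - C))"
      using fin finC by (intro card_mono) (auto simp: finite_hits)
    also have "\<dots> \<le> card (hits A C W \<inter> ?S) + card (?S - C)" by (rule card_Un_le)
    finally show ?thesis .
  qed
  moreover have "card ?S = card (?S \<inter> C) + card (?S - C)"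
    by (rule card_Int_Diff) (simp add: finite_hits fin)
  moreover have "card (hits A C W) = card (hits A C W \<inter> ?S) + card (hits A C W - ?S)"
    by (rule card_Int_Diff) (simp add: finite_hits finC)
  moreover have "card (Y \<union> X - W) = card (Y - X - W) + card (X - W)"
  proof -
    have "Y \<union> X - W = (Y - X - W) \<union> (X - W)" by auto
    moreover have "card ((Y - X - W) \<union> (X - W)) = card (Y - X - W) + card (X - W)"
      using fin by (intro card_Un_disjoint) auto
    ultimately show ?thesis by simp
  qed
  ultimately show "trank A (C - ?S) Y + card (?S \<inter> C) \<le> trank A C (Y \<union> X)"
    using W(2) by linarith
qed

lemma trank_empty [simp]: "trank A C {} = 0"
  using trank_le_card[of "{}" A C] by simp

lemma hits_disjoint_if_trank_zero:
  assumes "finite Y" "finite C" "trank A C Y = 0"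
  shows "hits A C Y = {}"
proof -
  obtain V where V: "V \<subseteq> Y" "trank A C Y = card (hits A C V) + card (Y - V)"
    using trank_attained[OF assms(1)] .
  then have "card (hits A C V) = 0" "card (Y - V) = 0" using assms(3) by auto
  then have "hits A C V = {}" "Y - V = {}"
    using finite_hits[OF assms(2), of A V] assms(1) by (simp_all add: card_eq_0_iff)
  then show ?thesis using V(1) by auto
qed

section \<open>Tight sets and avoidable indices\<close>

text \<open>
  By Hall's theorem, a matchable set that cannot avoid the index \<open>i\<close> has a tight subset whose
  support contains \<open>i\<close>; tight subsets of a matchable set are closed under union.
\<close>

lemma unavoidable_iff_tight_subset:
  assumes "finite Z" "finite R" "I \<subseteq> R" "matchable A R Z"
  shows "(\<forall>i\<in>I. \<not> matchable A (R - {i}) Z) \<longleftrightarrow>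
    (\<exists>Y\<subseteq>Z. card (hits A R Y) = card Y \<and> I \<subseteq> hits A R Y)"
proof
  assume "\<exists>Y\<subseteq>Z. card (hits A R Y) = card Y \<and> I \<subseteq> hits A R Y"
  then obtain Y where Y: "Y \<subseteq> Z" "card (hits A R Y) = card Y" "I \<subseteq> hits A R Y" by blast
  show "\<forall>i\<in>I. \<not> matchable A (R - {i}) Z"
  proof (intro ballI notI)
    fix i assume i: "i \<in> I" "matchable A (R - {i}) Z"
    have "card Y \<le> card (hits A (R - {i}) Y)"
      using assms(2) matchable_subset[OF i(2) Y(1)] by (intro matchable_card_le) auto
    moreover have "hits A (R - {i}) Y = hits A R Y - {i}" by (auto simp: hits_def)
    ultimately show False
      using Y i(1) card_Diff1_less[OF finite_hits[OF assms(2)], of i A Y] by auto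
  qed
next
  assume unavoidable: "\<forall>i\<in>I. \<not> matchable A (R - {i}) Z"
  have "finite I" using assms finite_subset by blast
  then show "\<exists>Y\<subseteq>Z. card (hits A R Y) = card Y \<and> I \<subseteq> hits A R Y"
    using unavoidable
  proof (induction I)
    case empty
    show ?case by (intro exI[of _ "{}"]) auto
  next
    case (insert i I)
    then obtain Y1 where Y1: "Y1 \<subseteq> Z" "card (hits A R Y1) = card Y1" "I \<subseteq> hits A R Y1" by auto
    have hall: "card Y \<le> card (hits A R Y)" if "Y \<subseteq> Z" for Y
      using matchable_card_le[OF assms(2) matchable_subset[OF assms(4) that]] .
    have "\<not> matchable A (R - {i}) Z" using insert.prems by simp
    \<comment> \<open>\<open>Y2\<close> violates Hall's condition once \<open>i\<close> is gone.
      Deleting one index costs at most one hit, so \<open>Y2\<close> was tight and \<open>i\<close>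
      is among its hits.\<close>
    then obtain Y2 where Y2: "Y2 \<subseteq> Z" "\<not> card Y2 \<le> card (hits A (R - {i}) Y2)"
      using hall_sufficient[OF assms(1), of "R - {i}" A] assms(2) by auto
    have eq: "hits A (R - {i}) Y2 = hits A R Y2 - {i}" by (auto simp: hits_def)
    have i: "i \<in> hits A R Y2" using Y2 eq hall[of Y2] by (cases "i \<in> hits A R Y2") auto
    then have "card (hits A R Y2 - {i}) = card (hits A R Y2) - 1" by simp
    then have tight2: "card (hits A R Y2) = card Y2" using Y2 eq hall[of Y2] by auto
    have fin: "finite Y1" "finite Y2" using Y1 Y2 assms(1) finite_subset by blast+
    have "card (hits A R (Y1 \<union> Y2)) + card (hits A R (Y1 \<inter> Y2)) \<le> card (hits A R Y1) + card (hits A R Y2)"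
      using assms(2) by (intro card_add_le_card_add) (auto simp: hits_def)
    moreover have "card (Y1 \<union> Y2) \<le> card (hits A R (Y1 \<union> Y2))"
      "card (Y1 \<inter> Y2) \<le> card (hits A R (Y1 \<inter> Y2))"
      using Y1 Y2 by (auto intro!: hall)
    moreover have "card Y1 + card Y2 = card (Y1 \<union> Y2) + card (Y1 \<inter> Y2)"
      using fin by (rule card_Un_Int)
    ultimately have "card (hits A R (Y1 \<union> Y2)) = card (Y1 \<union> Y2)"
      using Y1(2) tight2 by linarith
    then show ?case
      using Y1 Y2 i by (intro exI[of _ "Y1 \<union> Y2"]) (auto simp: hits_Un)
  qed
qed

text \<open>A matching that avoids one index of \<open>I\<close> loses at most
  \<open>card I - 1\<close> more when the others are deleted. If no index can be avoided, a tight
  set whose hits include \<open>I\<close> bounds the rank over \<open>R - I\<close> by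
  \<open>card Z - card I\<close>. Avoidance thus becomes a condition on ranks of the reduced
  system.\<close>

lemma avoidable_iff_trank:
  assumes "finite Z" "finite R" "I \<subseteq> R" "matchable A R Z"
  shows "(\<exists>i\<in>I. matchable A (R - {i}) Z) \<longleftrightarrow> card Z < trank A (R - I) Z + card I"
proof
  assume "\<exists>i\<in>I. matchable A (R - {i}) Z"
  then obtain i where i: "i \<in> I" "matchable A (R - {i}) Z" by blast
  have finI: "finite I" using assms finite_subset by blast
  have "trank A (R - {i}) Z \<le> trank A (R - I) Z + card ((R - {i}) - (R - I))"
    using assms i by (intro trank_le_add_card_indices) auto
  moreover have "(R - {i}) - (R - I) = I - {i}" using assms(3) by auto
  moreover have "card (I - {i}) < card I" using finI i by (intro card_Diff1_less)
  moreover have "trank A (R - {i}) Z = card Z"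
    using i(2) matchable_iff_trank[of Z "R - {i}" A] assms by simp
  ultimately show "card Z < trank A (R - I) Z + card I" by simp
next
  assume less: "card Z < trank A (R - I) Z + card I"
  show "\<exists>i\<in>I. matchable A (R - {i}) Z"
  proof (rule ccontr)
    assume "\<not> (\<exists>i\<in>I. matchable A (R - {i}) Z)"
    then obtain Y where Y: "Y \<subseteq> Z" "card (hits A R Y) = card Y" "I \<subseteq> hits A R Y"
      using unavoidable_iff_tight_subset[OF assms] by blast
    have "hits A (R - I) Y = hits A R Y - I" by (auto simp: hits_def)
    then have "card (hits A (R - I) Y) = card Y - card I"
      using Y by (simp add: card_Diff_subset finite_subset[OF Y(3) finite_hits[OF assms(2)]])
    moreover have "card I \<le> card Y"
      using card_mono[OF finite_hits[OF assms(2)] Y(3)] Y(2) by simp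
    moreover have "card Z = card Y + card (Z - Y)"
      using Y(1) assms(1) by (simp add: card_Diff_subset card_mono finite_subset)
    ultimately show False using less trank_le[OF assms(1) Y(1), of A "R - I"] by linarith
  qed
qed

text \<open>Contraction of \<open>X\<close> with no further elements. On such a set the rank is a
  cardinality, hence modular in the indices.\<close>

lemma trank_subset_if_full:
  assumes "finite X" "finite R" "C \<subseteq> R" "trank A R X = card (hits A R X)"
  shows "trank A C X = card (hits A R X \<inter> C)"
  using trank_contract[OF assms(1) finite.emptyI assms(2-4)] by simp

text \<open>
  On an optimal set \<open>V\<close> of the min-formula for \<open>C1 \<union> C2\<close> the ranks on the \<open>A\<close>-side are
  cardinalities, hence modular in the index set, while those on the \<open>B\<close>-side are submodular.
\<close>

lemma trank_Un_indices_le: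
  assumes fin: "finite Y" "finite C1" "finite C2" "finite D1" "finite D2"
    and agree: "\<And>V. V \<subseteq> Y \<Longrightarrow> trank A C1 V = trank B D1 V"
      "\<And>V. V \<subseteq> Y \<Longrightarrow> trank A C2 V = trank B D2 V"
      "\<And>V. V \<subseteq> Y \<Longrightarrow> trank A (C1 \<inter> C2) V = trank B (D1 \<inter> D2) V"
  shows "trank B (D1 \<union> D2) Y \<le> trank A (C1 \<union> C2) Y"
proof -
  let ?C = "C1 \<union> C2"
  obtain V where V: "V \<subseteq> Y" "trank A ?C Y = card (hits A ?C V) + card (Y - V)"
    using trank_attained[OF fin(1)] .
  let ?H = "hits A ?C V"
  have finV: "finite V" and finC: "finite ?C" using V(1) fin finite_subset by auto
  have finH: "finite ?H" using finC by (rule finite_hits)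
  \<comment> \<open>The elements of \<open>Y - V\<close> raise the rank by at most their number, so
    optimality of \<open>V\<close> leaves no room for a smaller rank on \<open>V\<close>.\<close>
  have "trank A ?C V = card ?H"
    using trank_le_add_card_elements[OF fin(1) V(1), of A ?C] V(2)
      trank_le_card_hits[OF finV, of A ?C] by linarith
  then have full: "trank A K V = card (?H \<inter> K)" if "K \<subseteq> ?C" for K
    using trank_subset_if_full[OF finV finC that] by simp
  have "trank B (D1 \<union> D2) V + trank B (D1 \<inter> D2) V \<le> trank B D1 V + trank B D2 V"
    using trank_bisubmodular[OF fin(4,5) finV finV] by simp
  moreover have "trank B D1 V = card (?H \<inter> C1)" "trank B D2 V = card (?H \<inter> C2)"
    "trank B (D1 \<inter> D2) V = card (?H \<inter> (C1 \<inter> C2))"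
    using agree(1)[OF V(1)] agree(2)[OF V(1)] agree(3)[OF V(1)] full[of C1] full[of C2]
      full[of "C1 \<inter> C2"] by auto
  moreover have "card (?H \<inter> C1) + card (?H \<inter> C2) \<le> card ?H + card (?H \<inter> (C1 \<inter> C2))"
    using finH by (intro card_add_le_card_add) auto
  ultimately have "trank B (D1 \<union> D2) V \<le> card ?H" by linarith
  then show ?thesis
    using trank_le_add_card_elements[OF fin(1) V(1), of B "D1 \<union> D2"] V(2) by linarith
qed

section \<open>Single-element extensions of a presented matroid\<close>

text \<open>
  A name for the index set \<open>[r]\<close>, so that the equation expressing the rank through \<open>trank\<close> does
  not contain its own left-hand side.
\<close>

definition indices :: "'a matroid \<Rightarrow> nat set" where
  "indices M = {1..full_rank M}"

lemma finite_indices [simp]: "finite (indices M)"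
  by (simp add: indices_def)

lemma card_indices: "card (indices M) = full_rank M"
  by (simp add: indices_def)

text \<open>For \<open>I \<subseteq> [r]\<close>, this says that \<open>Z \<union> {x}\<close> is independent in \<open>M[\<A>\<^sup>I]\<close>.\<close>

definition avoids :: "'a matroid \<Rightarrow> (nat \<Rightarrow> 'a set) \<Rightarrow> nat set \<Rightarrow> 'a set \<Rightarrow> bool" where
  "avoids M A I Z \<longleftrightarrow> (\<exists>i\<in>I. matchable A (indices M - {i}) Z)"

definition tight_indep :: "'a matroid \<Rightarrow> (nat \<Rightarrow> 'a set) \<Rightarrow> 'a set \<Rightarrow> bool" where
  "tight_indep M A Y \<longleftrightarrow> Y \<in> indep M \<and> card (supp M A Y) = card Y"

lemma supp_eq_hits: "supp M A X = hits A (indices M) X"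
  by (simp add: supp_def hits_def indices_def)

lemma supp_subset: "supp M A X \<subseteq> indices M"
  by (auto simp: supp_def indices_def)

lemma L_sets_subset: "I \<in> L_sets M A x \<Longrightarrow> I \<subseteq> indices M"
  by (simp add: L_sets_def indices_def)

lemma finite_supp: "finite (supp M A X)"
  by (simp add: supp_def)

lemma supp_mono: "X \<subseteq> Y \<Longrightarrow> supp M A X \<subseteq> supp M A Y"
  by (auto simp: supp_def)

locale presented_matroid =
  fixes M :: "'a matroid" and A :: "nat \<Rightarrow> 'a set" and x :: 'a
  assumes finite_ground: "finite (ground M)"
    and pres: "presentation M A"
    and new: "x \<notin> ground M"
begin

abbreviation "R \<equiv> indices M"
abbreviation "E \<equiv> ground M"

lemma finite_subset_ground: "Z \<subseteq> E \<Longrightarrow> finite Z"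
  using finite_ground finite_subset by blast

lemma sets_subset: "i \<in> R \<Longrightarrow> A i \<subseteq> E"
  using pres by (simp add: presentation_def indices_def)

lemma indep_iff: "Z \<in> indep M \<longleftrightarrow> Z \<subseteq> E \<and> matchable A R Z"
proof -
  have "M = transversal_matroid E (full_rank M) A"
    using pres unfolding presentation_def by blast
  then have "indep M = indep (transversal_matroid E (full_rank M) A)"
    by (rule arg_cong)
  then show ?thesis
    by (simp add: transversal_matroid_def partial_transversal_def matchable_def indices_def)
qed

lemma rank_eq_trank:
  assumes "X \<subseteq> E"
  shows "rank M X = trank A R X"
  unfolding rank_def
proof (rule Max_eqI)
  have "{card I |I. I \<subseteq> X \<and> I \<in> indep M} \<subseteq> card ` Pow X" by auto
  then show "finite {card I |I. I \<subseteq> X \<and> I \<in> indep M}"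
    using finite_subset_ground[OF assms] by (meson finite_Pow_iff finite_imageI finite_subset)
next
  fix n assume "n \<in> {card I |I. I \<subseteq> X \<and> I \<in> indep M}"
  then show "n \<le> trank A R X"
    using matchable_card_le_trank[OF finite_subset_ground[OF assms]] by (auto simp: indep_iff)
next
  obtain Z where "Z \<subseteq> X" "matchable A R Z" "card Z = trank A R X"
    using trank_basis[OF finite_subset_ground[OF assms] finite_indices] .
  then show "trank A R X \<in> {card I |I. I \<subseteq> X \<and> I \<in> indep M}"
    using assms by (auto simp: indep_iff intro!: exI[of _ Z])
qed

lemma indep_iff_rank:
  assumes "Z \<subseteq> E"
  shows "Z \<in> indep M \<longleftrightarrow> rank M Z = card Z"
  using assms matchable_iff_trank[OF finite_subset_ground[OF assms], of R A]
  by (simp add: indep_iff rank_eq_trank)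

text \<open>The system has only as many sets as the rank, and the rank is at most the number of sets
  that are not empty.\<close>

lemma supp_ground: "supp M A E = R"
proof (rule card_subset_eq[OF _ supp_subset])
  have "card R = trank A R E" using rank_eq_trank[of E] by (simp add: card_indices)
  also have "\<dots> \<le> card (supp M A E)"
    using trank_le_card_hits[OF finite_ground] by (simp add: supp_eq_hits)
  finally show "card (supp M A E) = card R"
    using card_mono[OF _ supp_subset[of M A E]] by simp
qed simp

text \<open>Its use is to recover the size of an index set from the ranks of the system that remains
  after its deletion.\<close>

lemma trank_ground:
  assumes "C \<subseteq> R"
  shows "trank A C E = card C"
proof -
  have "trank A R E = card (hits A R E)"
    using rank_eq_trank[of E] supp_ground by (simp add: supp_eq_hits card_indices)
  then have "trank A C E = card (hits A R E \<inter> C)"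
    using trank_subset_if_full[OF finite_ground _ assms] by simp
  then show ?thesis using supp_ground assms by (simp add: supp_eq_hits Int_absorb1)
qed

lemma subset_closure_iff:
  assumes "X \<subseteq> E" "Z \<subseteq> E"
  shows "X \<subseteq> closure M Z \<longleftrightarrow> rank M (Z \<union> X) = rank M Z"
proof
  assume cl: "X \<subseteq> closure M Z"
  have "trank A R (insert e Z) = trank A R Z" if "e \<in> X" for e
    using that cl assms rank_eq_trank[of "insert e Z"] rank_eq_trank[of Z]
    by (auto simp: closure_def)
  then show "rank M (Z \<union> X) = rank M Z"
    using trank_Un_eq[OF finite_subset_ground[OF assms(1)] finite_subset_ground[OF assms(2)]]
      assms by (simp add: rank_eq_trank)
next
  assume eq: "rank M (Z \<union> X) = rank M Z"
  show "X \<subseteq> closure M Z"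
  proof
    fix e assume e: "e \<in> X"
    have "trank A R Z \<le> trank A R (insert e Z)" "trank A R (insert e Z) \<le> trank A R (Z \<union> X)"
      using e assms finite_subset_ground by (auto intro!: trank_mono)
    then show "e \<in> closure M Z"
      using eq e assms by (auto simp: closure_def rank_eq_trank)
  qed
qed

section \<open>Independent sets of the extensions\<close>

text \<open>The original sets lie in the ground set, so \<open>x\<close> can be matched only to an
  index in \<open>I\<close>; the rest of the matching covers \<open>Z\<close> without this
  index.\<close>

lemma insert_new_matchable_iff:
  assumes "Z \<subseteq> E" "I \<subseteq> R"
  shows "matchable (extend_system A x I) R (insert x Z) \<longleftrightarrow> avoids M A I Z"
proof
  assume "matchable (extend_system A x I) R (insert x Z)"
  then obtain f where f: "inj_on f (insert x Z)"
      "\<forall>z\<in>insert x Z. f z \<in> R \<and> z \<in> extend_system A x I (f z)"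
    by (auto simp: matchable_def)
  have fx: "f x \<in> I"
    using f(2) new sets_subset[of "f x"] by (auto simp: extend_system_def split: if_splits)
  have "x \<notin> Z" using assms new by auto
  then have "inj_on f Z" "\<forall>z\<in>Z. f z \<in> R - {f x} \<and> z \<in> A (f z)"
    using f by (auto simp: inj_on_def extend_system_def split: if_splits)
  then show "avoids M A I Z" using fx unfolding avoids_def matchable_def by blast
next
  assume "avoids M A I Z"
  then obtain i f where f: "i \<in> I" "inj_on f Z" "\<forall>z\<in>Z. f z \<in> R - {i} \<and> z \<in> A (f z)"
    unfolding avoids_def matchable_def by blast
  have "x \<notin> Z" using assms new by auto
  then have "inj_on (f(x := i)) (insert x Z)"
    using f by (auto simp: inj_on_def)
  moreover have "\<forall>z\<in>insert x Z. (f(x := i)) z \<in> R \<and> z \<in> extend_system A x I ((f(x := i)) z)"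
    using f assms(2) \<open>x \<notin> Z\<close> by (auto simp: extend_system_def)
  ultimately show "matchable (extend_system A x I) R (insert x Z)"
    unfolding matchable_def by blast
qed

lemma old_matchable_iff:
  assumes "Z \<subseteq> E"
  shows "matchable (extend_system A x I) R Z \<longleftrightarrow> matchable A R Z"
proof -
  have "z \<in> extend_system A x I i \<longleftrightarrow> z \<in> A i" if "z \<in> Z" for z i
    using that assms new by (auto simp: extend_system_def)
  then show ?thesis by (simp add: matchable_def)
qed

lemma indep_ext_iff:
  assumes "I \<subseteq> R"
  shows "W \<in> indep (ext_matroid M A x I) \<longleftrightarrow> W \<subseteq> insert x E \<and>
    (if x \<in> W then avoids M A I (W - {x}) else W \<in> indep M)"
proof -
  have "W \<in> indep (ext_matroid M A x I) \<longleftrightarrow>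
      W \<subseteq> insert x E \<and> matchable (extend_system A x I) R W"
    by (simp add: ext_matroid_def transversal_matroid_def partial_transversal_def matchable_def
        indices_def)
  also have "\<dots> \<longleftrightarrow> W \<subseteq> insert x E \<and>
      (if x \<in> W then avoids M A I (W - {x}) else W \<in> indep M)"
  proof (cases "W \<subseteq> insert x E")
    case True
    then have "W - {x} \<subseteq> E" by auto
    then show ?thesis
      using insert_new_matchable_iff[of "W - {x}" I] old_matchable_iff[of W I] assms True
      by (auto simp: indep_iff insert_absorb)
  qed simp
  finally show ?thesis .
qed

lemma ground_ext [simp]: "ground (ext_matroid M A x I) = insert x E"
  by (simp add: ext_matroid_def transversal_matroid_def)

lemma avoids_indep:
  assumes "avoids M A I Z" "Z \<subseteq> E"
  shows "Z \<in> indep M"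
  using assms unfolding avoids_def indep_iff matchable_def by blast

lemma avoids_subset: "avoids M A I Z \<Longrightarrow> Y \<subseteq> Z \<Longrightarrow> avoids M A I Y"
  unfolding avoids_def using matchable_subset by blast

text \<open>Extensions of \<open>M\<close> by \<open>x\<close> can differ only on sets that contain
  \<open>x\<close>. The predicate \<open>P\<close> is left open so that \<open>N\<close> may be an
  extension from another presentation or a principal extension.\<close>

lemma ext_eq_iff:
  assumes "I \<subseteq> R" "ground N = insert x E"
    and "\<And>W. W \<in> indep N \<longleftrightarrow> W \<subseteq> insert x E \<and> (if x \<in> W then P (W - {x}) else W \<in> indep M)"
  shows "ext_matroid M A x I = N \<longleftrightarrow> (\<forall>Z\<subseteq>E. avoids M A I Z \<longleftrightarrow> P Z)"
proof
  assume eq: "ext_matroid M A x I = N"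
  show "\<forall>Z\<subseteq>E. avoids M A I Z \<longleftrightarrow> P Z"
  proof (intro allI impI)
    fix Z assume Z: "Z \<subseteq> E"
    then have "x \<notin> Z" "insert x Z \<subseteq> insert x E" using new by auto
    then show "avoids M A I Z \<longleftrightarrow> P Z"
      using assms(3)[of "insert x Z"] indep_ext_iff[OF assms(1), of "insert x Z"] eq by simp
  qed
next
  assume iff: "\<forall>Z\<subseteq>E. avoids M A I Z \<longleftrightarrow> P Z"
  have "indep (ext_matroid M A x I) = indep N"
  proof (rule set_eqI)
    fix W
    show "W \<in> indep (ext_matroid M A x I) \<longleftrightarrow> W \<in> indep N"
    proof (cases "W \<subseteq> insert x E")
      case True
      then have "W - {x} \<subseteq> E" by auto
      then show ?thesis using iff assms(3) indep_ext_iff[OF assms(1)] by simp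
    qed (use assms(3) indep_ext_iff[OF assms(1)] in blast)
  qed
  then show "ext_matroid M A x I = N"
    using assms(2) by (intro matroid.expand) simp
qed

text \<open>The rank of \<open>W - {x}\<close> is at most its size. So when \<open>x\<close> is in
  \<open>W\<close>, the extension rank reaches \<open>card W\<close> only if \<open>W - {x}\<close>
  is independent and the summand 1 is gained.\<close>

lemma ext_eq_principal_iff:
  assumes "I \<subseteq> R"
  shows "ext_matroid M A x I = principal_extension M Y x \<longleftrightarrow>
    (\<forall>Z\<subseteq>E. avoids M A I Z \<longleftrightarrow> Z \<in> indep M \<and> \<not> Y \<subseteq> closure M Z)"
proof (rule ext_eq_iff[OF assms])
  show "ground (principal_extension M Y x) = insert x E"
    by (simp add: principal_extension_def)
  fix W
  show "W \<in> indep (principal_extension M Y x) \<longleftrightarrow> W \<subseteq> insert x E \<and>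
    (if x \<in> W then W - {x} \<in> indep M \<and> \<not> Y \<subseteq> closure M (W - {x}) else W \<in> indep M)"
  proof (cases "W \<subseteq> insert x E")
    case True
    show ?thesis
    proof (cases "x \<in> W")
      case x: True
      have sub: "W - {x} \<subseteq> E" using True by auto
      have fin: "finite (W - {x})" using sub by (rule finite_subset_ground)
      have "card W = card (W - {x}) + 1"
        using fin x by (metis Suc_eq_plus1 card.remove finite_Diff2 finite.emptyI finite_insert)
      moreover have "rank M (W - {x}) \<le> card (W - {x})"
        using rank_eq_trank[OF sub] trank_le_card[OF fin] by simp
      ultimately show ?thesis
        using x True indep_iff_rank[OF sub]
        by (auto simp: principal_extension_def principal_ext_rank_def)
    next
      case False
      then have "W \<subseteq> E" using True by auto
      then show ?thesis
        using False True indep_iff_rank[of W]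
        by (simp add: principal_extension_def principal_ext_rank_def)
    qed
  qed (simp add: principal_extension_def)
qed

section \<open>The lattice of closed index sets\<close>

lemma not_avoids_iff:
  assumes "Z \<in> indep M" "I \<subseteq> R"
  shows "\<not> avoids M A I Z \<longleftrightarrow> (\<exists>Y\<subseteq>Z. tight_indep M A Y \<and> I \<subseteq> supp M A Y)"
proof -
  have Z: "Z \<subseteq> E" "matchable A R Z" using assms(1) by (auto simp: indep_iff)
  have "\<not> avoids M A I Z \<longleftrightarrow> (\<exists>Y\<subseteq>Z. card (supp M A Y) = card Y \<and> I \<subseteq> supp M A Y)"
    using unavoidable_iff_tight_subset[OF finite_subset_ground[OF Z(1)] _ assms(2) Z(2)]
    by (simp add: avoids_def supp_eq_hits)
  moreover have "Y \<in> indep M" if "Y \<subseteq> Z" for Y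
    using that Z matchable_subset by (auto simp: indep_iff)
  ultimately show ?thesis by (auto simp: tight_indep_def)
qed

text \<open>Supports grow with the set, so on a tight set the witness for dependence on
  \<open>x\<close> may be the set itself.\<close>

lemma not_avoids_tight_iff:
  assumes "tight_indep M A Y" "I \<subseteq> R"
  shows "\<not> avoids M A I Y \<longleftrightarrow> I \<subseteq> supp M A Y"
  using not_avoids_iff[of Y I] assms supp_mono[of _ Y M A] unfolding tight_indep_def by blast

text \<open>Such a \<open>Y\<close> is a circuit through \<open>x\<close> with \<open>x\<close>
  removed. The tight witness inside \<open>Y\<close> does not avoid \<open>I\<close> either, so by
  minimality it is all of \<open>Y\<close>.\<close>

lemma minimal_not_avoiding_tight:
  assumes "Y \<in> indep M" "I \<subseteq> R" "\<not> avoids M A I Y" "\<And>Y'. Y' \<subset> Y \<Longrightarrow> avoids M A I Y'"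
  shows "tight_indep M A Y" "I \<subseteq> supp M A Y"
proof -
  obtain Y' where Y': "Y' \<subseteq> Y" "tight_indep M A Y'" "I \<subseteq> supp M A Y'"
    using not_avoids_iff[OF assms(1,2)] assms(3) by blast
  then have "\<not> avoids M A I Y'" using not_avoids_tight_iff assms(2) by blast
  then have "Y' = Y" using assms(4)[of Y'] Y'(1) by blast
  then show "tight_indep M A Y" "I \<subseteq> supp M A Y" using Y' by auto
qed

text \<open>A basis of the deletion without \<open>x\<close> cannot be enlarged by \<open>x\<close>,
  so it contains a tight witness; lying outside \<open>A k\<close>, that witness has a support
  without \<open>k\<close>. Conversely such a witness extends to a basis without
  \<open>x\<close>.\<close>

lemma coloop_delete_iff:
  assumes "I \<subseteq> R" "k \<in> R"
  shows "coloop (delete (ext_matroid M A x I) (A k)) x \<longleftrightarrow>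
    (\<forall>Y. tight_indep M A Y \<and> I \<subseteq> supp M A Y \<longrightarrow> k \<in> supp M A Y)"
proof -
  let ?D = "delete (ext_matroid M A x I) (A k)"
  have x: "x \<notin> A k" using sets_subset[OF assms(2)] new by auto
  have groundD: "ground ?D = insert x (E - A k)" using x by (auto simp: delete_def)
  have indepD: "W \<in> indep ?D \<longleftrightarrow> W \<subseteq> insert x (E - A k) \<and>
      (if x \<in> W then avoids M A I (W - {x}) else W \<in> indep M)" for W
    using indep_ext_iff[OF assms(1), of W] x by (auto simp: delete_def)
  have "\<not> coloop ?D x \<longleftrightarrow> (\<exists>B. basis ?D B \<and> x \<notin> B)"
    using groundD by (auto simp: coloop_def)
  also have "\<dots> \<longleftrightarrow> (\<exists>Y. tight_indep M A Y \<and> I \<subseteq> supp M A Y \<and> k \<notin> supp M A Y)"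
  proof
    assume "\<exists>B. basis ?D B \<and> x \<notin> B"
    then obtain B where B: "basis ?D B" "x \<notin> B" by (elim exE conjE)
    have "B \<in> indep ?D" using B(1) by (simp add: basis_def)
    then have B': "B \<subseteq> E - A k" "B \<in> indep M" using B(2) indepD[of B] by auto
    have "insert x B = B" if "insert x B \<in> indep ?D"
      using B(1) that unfolding basis_def by (auto simp del: insert_subset)
    then have "insert x B \<notin> indep ?D" using B(2) by auto
    then have "\<not> avoids M A I B" using indepD[of "insert x B"] B(2) B'(1) by auto
    then obtain Y where Y: "Y \<subseteq> B" "tight_indep M A Y" "I \<subseteq> supp M A Y"
      using not_avoids_iff[OF B'(2) assms(1)] by blast
    moreover have "k \<notin> supp M A Y" using Y(1) B'(1) by (auto simp: supp_def)
    ultimately show "\<exists>Y. tight_indep M A Y \<and> I \<subseteq> supp M A Y \<and> k \<notin> supp M A Y" by blast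
  next
    assume "\<exists>Y. tight_indep M A Y \<and> I \<subseteq> supp M A Y \<and> k \<notin> supp M A Y"
    then obtain Y where Y: "tight_indep M A Y" "I \<subseteq> supp M A Y" "k \<notin> supp M A Y" by blast
    have YE: "Y \<subseteq> E - A k" "Y \<in> indep M"
      using Y assms(2) by (auto simp: tight_indep_def indep_iff supp_eq_hits hits_def)
    \<comment> \<open>\<open>Y\<close> keeps \<open>x\<close> out of every independent superset, so
      a set that is maximal among those without \<open>x\<close> is a basis of the whole
      deletion.\<close>
    let ?F = "{Z. Z \<subseteq> E - A k \<and> Z \<in> indep M}"
    have "finite ?F" by (rule finite_subset[of _ "Pow E"]) (auto simp: finite_ground)
    moreover have "Y \<in> ?F" using YE by simp
    ultimately have "\<exists>Z\<in>?F. Y \<subseteq> Z \<and> (\<forall>Z'\<in>?F. Z \<subseteq> Z' \<longrightarrow> Z = Z')"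
      by (rule finite_has_maximal2)
    then obtain Z where Z: "Z \<in> ?F" "Y \<subseteq> Z" and max: "\<forall>Z'\<in>?F. Z \<subseteq> Z' \<longrightarrow> Z = Z'"
      by (elim bexE conjE)
    have "x \<notin> Z" using Z(1) new by auto
    moreover have "basis ?D Z"
      unfolding basis_def
    proof (intro conjI ballI impI)
      show "Z \<in> indep ?D" using Z(1) \<open>x \<notin> Z\<close> by (auto simp: indepD)
      fix W assume W: "W \<in> indep ?D" "Z \<subseteq> W"
      have "x \<notin> W"
      proof
        assume "x \<in> W"
        then have "avoids M A I (W - {x})" using W(1) indepD by auto
        moreover have "Y \<subseteq> W - {x}" using W(2) Z(2) \<open>x \<notin> Z\<close> by auto
        ultimately have "avoids M A I Y" by (rule avoids_subset)
        then show False using not_avoids_tight_iff[OF Y(1) assms(1)] Y(2) by blast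
      qed
      then have "W \<in> ?F" using W(1) indepD by auto
      then show "W = Z" using bspec[OF max, of W] W(2) by simp
    qed
    ultimately show "\<exists>B. basis ?D B \<and> x \<notin> B" by (intro exI conjI)
  qed
  finally show ?thesis by auto
qed

text \<open>Closed index sets are thus the intersections of supports of tight independent sets,
  which makes their closure under intersection immediate.\<close>

lemma L_sets_iff:
  "I \<in> L_sets M A x \<longleftrightarrow> I \<subseteq> R \<and>
    (\<forall>k\<in>R - I. \<exists>Y. tight_indep M A Y \<and> I \<subseteq> supp M A Y \<and> k \<notin> supp M A Y)"
proof (cases "I \<subseteq> R")
  case True
  have "sigma M A x I = I \<longleftrightarrow>
      (\<forall>k\<in>R - I. \<not> coloop (delete (ext_matroid M A x I) (A k)) x)"
    unfolding sigma_def indices_def by blast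
  also have "\<dots> \<longleftrightarrow>
      (\<forall>k\<in>R - I. \<exists>Y. tight_indep M A Y \<and> I \<subseteq> supp M A Y \<and> k \<notin> supp M A Y)"
    using coloop_delete_iff[OF True] by (intro ball_cong refl) auto
  finally show ?thesis
    using True unfolding L_sets_def indices_def[symmetric] by simp
qed (simp add: L_sets_def indices_def)

lemma L_sets_separate:
  assumes "I \<in> L_sets M A x" "k \<in> R" "k \<notin> I"
  obtains Y where "tight_indep M A Y" "I \<subseteq> supp M A Y" "k \<notin> supp M A Y"
proof -
  have "\<exists>Y. tight_indep M A Y \<and> I \<subseteq> supp M A Y \<and> k \<notin> supp M A Y"
    using assms unfolding L_sets_iff by simp
  then show thesis using that by (elim exE conjE)
qed

lemma supp_tight_indep_in_L_sets: "tight_indep M A Y \<Longrightarrow> supp M A Y \<in> L_sets M A x"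
  unfolding L_sets_iff by (intro conjI supp_subset ballI exI[of _ Y]) auto

text \<open>Sets as in \<open>star\<close> may be dependent. A basis of \<open>X\<close> already
  hits as many indices as \<open>X\<close> does, by Hall's condition, and so can replace it.\<close>

lemma tight_indep_basis:
  assumes "X \<subseteq> E" "card (supp M A X) = rank M X"
  obtains Y where "Y \<subseteq> X" "tight_indep M A Y" "supp M A Y = supp M A X"
proof -
  obtain Y where Y: "Y \<subseteq> X" "matchable A R Y" "card Y = trank A R X"
    using trank_basis[OF finite_subset_ground[OF assms(1)] finite_indices] .
  have "card Y \<le> card (supp M A Y)"
    using matchable_card_le[OF _ Y(2)] by (simp add: supp_eq_hits)
  moreover have sub: "supp M A Y \<subseteq> supp M A X" by (rule supp_mono[OF Y(1)])
  then have "card (supp M A Y) \<le> card (supp M A X)" by (rule card_mono[OF finite_supp])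
  ultimately have eq: "card (supp M A Y) = card (supp M A X)" "card (supp M A Y) = card Y"
    using assms Y(3) rank_eq_trank by auto
  have "supp M A Y = supp M A X" by (rule card_subset_eq[OF finite_supp sub eq(1)])
  then show thesis using that Y eq assms(1) by (auto simp: tight_indep_def indep_iff)
qed

lemma supp_in_L_sets:
  assumes "X \<subseteq> E" "card (supp M A X) = rank M X"
  shows "supp M A X \<in> L_sets M A x"
proof -
  obtain Y where "tight_indep M A Y" "supp M A Y = supp M A X"
    using tight_indep_basis[OF assms] .
  then show ?thesis using supp_tight_indep_in_L_sets[of Y] by simp
qed

text \<open>The union of \<open>Y1\<close> and \<open>Y2\<close> may be dependent, so
  \<open>Y1\<close> receives only those elements of \<open>Y2\<close> whose matched index is
  new.\<close>

lemma tight_indep_Un: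
  assumes "tight_indep M A Y1" "tight_indep M A Y2"
  obtains Y where "tight_indep M A Y" "supp M A Y = supp M A Y1 \<union> supp M A Y2"
proof -
  obtain f where f: "inj_on f Y1" "\<forall>z\<in>Y1. f z \<in> R \<and> z \<in> A (f z)"
    using assms(1) by (auto simp: tight_indep_def indep_iff matchable_def)
  obtain g where g: "inj_on g Y2" "\<forall>z\<in>Y2. g z \<in> R \<and> z \<in> A (g z)"
    using assms(2) by (auto simp: tight_indep_def indep_iff matchable_def)
  have "f ` Y1 \<subseteq> supp M A Y1" "g ` Y2 \<subseteq> supp M A Y2"
    using f(2) g(2) by (auto simp: supp_eq_hits hits_def)
  \<comment> \<open>A matching of a tight set uses its whole support, by counting.\<close>
  then have fY: "f ` Y1 = supp M A Y1" and gY: "g ` Y2 = supp M A Y2"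
    using assms card_image[OF f(1)] card_image[OF g(1)]
    by (auto intro!: card_subset_eq[OF finite_supp] simp: tight_indep_def)
  let ?W = "{y \<in> Y2. g y \<notin> supp M A Y1}"
  have disj: "Y1 \<inter> ?W = {}" using g(2) by (auto simp: supp_eq_hits hits_def)
  have m1: "matchable A (f ` Y1) Y1" using f by (auto simp: matchable_def)
  have m2: "matchable A (g ` ?W) ?W"
    using g inj_on_subset[OF g(1)] unfolding matchable_def by (intro exI[of _ g]) auto
  have eq: "f ` Y1 \<union> g ` ?W = supp M A Y1 \<union> supp M A Y2"
    using fY gY by auto
  have m: "matchable A (supp M A Y1 \<union> supp M A Y2) (Y1 \<union> ?W)"
    using matchable_Un[OF m1 m2 _ disj] fY eq by auto
  then have "matchable A R (Y1 \<union> ?W)"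
    using supp_subset unfolding matchable_def by (meson Un_subset_iff subsetD)
  moreover have "Y1 \<union> ?W \<subseteq> E" using assms by (auto simp: tight_indep_def indep_iff)
  ultimately have ind: "Y1 \<union> ?W \<in> indep M" by (simp add: indep_iff)
  have supp: "supp M A (Y1 \<union> ?W) = supp M A Y1 \<union> supp M A Y2"
  proof (rule antisym)
    show "supp M A (Y1 \<union> ?W) \<subseteq> supp M A Y1 \<union> supp M A Y2" by (auto simp: supp_def)
    have "f ` Y1 \<union> g ` ?W \<subseteq> supp M A (Y1 \<union> ?W)"
      using f(2) g(2) by (auto simp: supp_eq_hits hits_def)
    then show "supp M A Y1 \<union> supp M A Y2 \<subseteq> supp M A (Y1 \<union> ?W)" unfolding eq .
  qed
  have fin: "finite Y1" "finite ?W"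
    using assms finite_subset_ground by (auto simp: tight_indep_def indep_iff)
  have "card (Y1 \<union> ?W) = card Y1 + card ?W" using fin disj by (rule card_Un_disjoint)
  also have "\<dots> = card (f ` Y1) + card (g ` ?W)"
    using card_image[OF f(1)] card_image[OF inj_on_subset[OF g(1)], of ?W] by auto
  also have "\<dots> = card (f ` Y1 \<union> g ` ?W)"
    using fin fY by (intro card_Un_disjoint[symmetric]) (auto simp: finite_supp)
  finally have "card (Y1 \<union> ?W) = card (supp M A (Y1 \<union> ?W))" using eq supp by simp
  then show thesis using that[OF _ supp] ind by (simp add: tight_indep_def)
qed

lemma L_sets_Un:
  assumes "I \<in> L_sets M A x" "J \<in> L_sets M A x"
  shows "I \<union> J \<in> L_sets M A x"
  unfolding L_sets_iff
proof (intro conjI ballI)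
  show "I \<union> J \<subseteq> R" using assms[THEN L_sets_subset] by simp
  fix k assume "k \<in> R - (I \<union> J)"
  then have k: "k \<in> R" "k \<notin> I" "k \<notin> J" by auto
  obtain Y1 where Y1: "tight_indep M A Y1" "I \<subseteq> supp M A Y1" "k \<notin> supp M A Y1"
    using L_sets_separate[OF assms(1) k(1,2)] .
  obtain Y2 where Y2: "tight_indep M A Y2" "J \<subseteq> supp M A Y2" "k \<notin> supp M A Y2"
    using L_sets_separate[OF assms(2) k(1,3)] .
  obtain Y where "tight_indep M A Y" "supp M A Y = supp M A Y1 \<union> supp M A Y2"
    using tight_indep_Un[OF Y1(1) Y2(1)] .
  then show "\<exists>Y. tight_indep M A Y \<and> I \<union> J \<subseteq> supp M A Y \<and> k \<notin> supp M A Y"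
    using Y1 Y2 by blast
qed

lemma L_sets_Inter:
  assumes "F \<noteq> {}" "F \<subseteq> L_sets M A x"
  shows "\<Inter>F \<in> L_sets M A x"
  unfolding L_sets_iff
proof (intro conjI ballI)
  obtain I where "I \<in> F" using assms(1) by auto
  then have "I \<subseteq> R" using assms(2) by (intro L_sets_subset) auto
  then show "\<Inter>F \<subseteq> R" using \<open>I \<in> F\<close> by auto
next
  fix k assume "k \<in> R - \<Inter>F"
  then obtain I where I: "I \<in> F" "k \<in> R" "k \<notin> I" by auto
  then have "I \<in> L_sets M A x" using assms(2) by auto
  from L_sets_separate[OF this I(2,3)]
  obtain Y where Y: "tight_indep M A Y" "I \<subseteq> supp M A Y" "k \<notin> supp M A Y" .
  then have "\<Inter>F \<subseteq> supp M A Y" using I(1) by auto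
  then show "\<exists>Y. tight_indep M A Y \<and> \<Inter>F \<subseteq> supp M A Y \<and> k \<notin> supp M A Y"
    using Y by auto
qed

text \<open>A tight set separating \<open>k\<close> from \<open>J\<close> spans \<open>x\<close> in
  one extension, hence in the other, so its support contains \<open>I\<close> as well.\<close>

lemma ext_matroid_subset_if_eq:
  assumes "I \<in> L_sets M A x" "J \<in> L_sets M A x" "ext_matroid M A x I = ext_matroid M A x J"
  shows "I \<subseteq> J"
proof
  have sub: "I \<subseteq> R" "J \<subseteq> R" using assms(1,2)[THEN L_sets_subset] by simp_all
  have iff: "\<forall>Z\<subseteq>E. avoids M A I Z \<longleftrightarrow> avoids M A J Z"
    using ext_eq_iff[OF sub(1) _ indep_ext_iff[OF sub(2)]] assms(3) by simp
  fix k assume k: "k \<in> I"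
  show "k \<in> J"
  proof (rule ccontr)
    assume "k \<notin> J"
    from L_sets_separate[OF assms(2) subsetD[OF sub(1) k] this]
    obtain Y where Y: "tight_indep M A Y" "J \<subseteq> supp M A Y" "k \<notin> supp M A Y" .
    have "Y \<subseteq> E" using Y(1) by (simp add: tight_indep_def indep_iff)
    then have "I \<subseteq> supp M A Y"
      using iff Y not_avoids_tight_iff[OF Y(1)] sub by blast
    then show False using k Y(3) by blast
  qed
qed

lemma inj_on_ext_matroid: "inj_on (ext_matroid M A x) (L_sets M A x)"
  by (intro inj_onI antisym ext_matroid_subset_if_eq) simp_all

section \<open>Principal extensions along tight sets\<close>

lemma avoids_iff_trank:
  assumes "Z \<in> indep M" "I \<subseteq> R"
  shows "avoids M A I Z \<longleftrightarrow> card Z < trank A (R - I) Z + card I"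
  using assms avoidable_iff_trank[OF finite_subset_ground, of Z R I A]
  by (simp add: avoids_def indep_iff)

lemma rank_Un_tight:
  assumes "X \<subseteq> E" "card (supp M A X) = rank M X" "Z \<subseteq> E"
  shows "rank M (Z \<union> X) = trank A (R - supp M A X) Z + card (supp M A X)"
proof -
  have "trank A R X = card (hits A R X)"
    using assms(1,2) by (simp add: rank_eq_trank supp_eq_hits)
  then have "trank A R (Z \<union> X) = trank A (R - hits A R X) Z + card (hits A R X \<inter> R)"
    using trank_contract[OF finite_subset_ground[OF assms(1)] finite_subset_ground[OF assms(3)]]
    by simp
  moreover have "hits A R X \<inter> R = hits A R X" using hits_subset by blast
  ultimately show ?thesis using assms(1,3) by (simp add: rank_eq_trank supp_eq_hits)
qed

text \<open>For independent \<open>Z\<close> both conditions say that \<open>X\<close> raises the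
  rank of \<open>Z\<close>: one by contraction of \<open>X\<close>, the other by the definition of
  closure.\<close>

lemma ext_supp_eq_principal_extension:
  assumes "X \<subseteq> E" "card (supp M A X) = rank M X"
  shows "ext_matroid M A x (supp M A X) = principal_extension M X x"
  unfolding ext_eq_principal_iff[OF supp_subset]
proof (intro allI impI)
  fix Z assume Z: "Z \<subseteq> E"
  show "avoids M A (supp M A X) Z \<longleftrightarrow> Z \<in> indep M \<and> \<not> X \<subseteq> closure M Z"
  proof (cases "Z \<in> indep M")
    case True
    have "rank M Z \<le> rank M (Z \<union> X)"
      using trank_mono[of R "Z \<union> X" Z A] finite_subset_ground[of "Z \<union> X"] Z assms(1)
      by (simp add: rank_eq_trank)
    then show ?thesis
      using True avoids_iff_trank[OF True supp_subset] rank_Un_tight[OF assms Z]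
        subset_closure_iff[OF assms(1) Z] indep_iff_rank[OF Z] by auto
  qed (use avoids_indep Z in blast)
qed

text \<open>Contracting \<open>W\<close> deletes its support and leaves \<open>Z\<close> with rank
  zero, so no remaining set meets \<open>Z\<close>.\<close>

lemma supp_subset_if_rank_Un:
  assumes "tight_indep M A W" "Z \<subseteq> E" "rank M (W \<union> Z) = rank M W"
  shows "supp M A Z \<subseteq> supp M A W"
proof -
  have W: "W \<subseteq> E" "card (supp M A W) = rank M W"
    using assms(1) indep_iff_rank[of W] by (auto simp: tight_indep_def indep_iff)
  have "trank A (R - supp M A W) Z = 0"
    using rank_Un_tight[OF W assms(2)] W(2) assms(3) by (simp add: Un_commute)
  then have "hits A (R - supp M A W) Z = {}"
    using hits_disjoint_if_trank_zero[OF finite_subset_ground[OF assms(2)]] by simp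
  then show ?thesis by (auto simp: supp_eq_hits hits_def)
qed

end

section \<open>Two presentations\<close>

locale two_presentations =
  A: presented_matroid M A x + B: presented_matroid M B x
  for M :: "'a matroid" and A B :: "nat \<Rightarrow> 'a set" and x :: 'a
begin

abbreviation "R \<equiv> indices M"
abbreviation "E \<equiv> ground M"

section \<open>Compatible pairs of index sets\<close>

text \<open>
  The systems \<open>(A\<^sub>i : i \<notin> I)\<close> and \<open>(B\<^sub>j : j \<notin> J)\<close> present the same matroid. Unlike equality of the
  extensions \<open>M[\<A>\<^sup>I]\<close> and \<open>M[\<B>\<^sup>J]\<close>, which it implies, this is visibly preserved by
  intersections.
\<close>

definition compatible :: "nat set \<Rightarrow> nat set \<Rightarrow> bool" where
  "compatible I J \<longleftrightarrow> I \<subseteq> R \<and> J \<subseteq> R \<and> (\<forall>Y\<subseteq>E. trank A (R - I) Y = trank B (R - J) Y)"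

lemma ext_eq_iff:
  assumes "I \<subseteq> R" "J \<subseteq> R"
  shows "ext_matroid M A x I = ext_matroid M B x J \<longleftrightarrow>
    (\<forall>Z\<subseteq>E. avoids M A I Z \<longleftrightarrow> avoids M B J Z)"
  by (rule A.ext_eq_iff[OF assms(1) _ B.indep_ext_iff[OF assms(2)]]) simp

lemma compatible_card:
  assumes "compatible I J"
  shows "card I = card J"
proof -
  have "I \<subseteq> R" "J \<subseteq> R" using assms by (auto simp: compatible_def)
  moreover have "card (R - I) = card (R - J)"
    using assms A.trank_ground[of "R - I"] B.trank_ground[of "R - J"]
    by (auto simp: compatible_def)
  ultimately show ?thesis
    using card_mono[of R I] card_mono[of R J] finite_subset[of I R] finite_subset[of J R]
    by (simp add: card_Diff_subset)
qed

text \<open>For independent \<open>Z\<close>, the rank criterion for avoidance sees \<open>I\<close>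
  only through its size and the ranks of the remaining system.\<close>

lemma compatible_ext_eq:
  assumes "compatible I J"
  shows "ext_matroid M A x I = ext_matroid M B x J"
proof -
  have sub: "I \<subseteq> R" "J \<subseteq> R" using assms by (auto simp: compatible_def)
  have "avoids M A I Z \<longleftrightarrow> avoids M B J Z" if Z: "Z \<subseteq> E" for Z
  proof (cases "Z \<in> indep M")
    case True
    then show ?thesis
      using A.avoids_iff_trank[OF True sub(1)] B.avoids_iff_trank[OF True sub(2)]
        compatible_card[OF assms] assms Z by (simp add: compatible_def)
  qed (use A.avoids_indep B.avoids_indep Z in blast)
  then show ?thesis using ext_eq_iff[OF sub] by blast
qed

lemma compatible_empty: "compatible {} {}"
  using A.rank_eq_trank B.rank_eq_trank by (simp add: compatible_def)

text \<open>Deleting the support of \<open>X\<close> from an already reduced system still acts as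
  contraction of \<open>X\<close>. The new ranks are differences of ranks of
  \<open>Y \<union> X\<close> and \<open>X\<close>, which agree by assumption.\<close>

lemma compatible_Un_supp:
  assumes "compatible I J" "tight M A B X"
  shows "compatible (I \<union> supp M A X) (J \<union> supp M B X)"
proof -
  have sub: "I \<subseteq> R" "J \<subseteq> R" using assms by (auto simp: compatible_def)
  have X: "X \<subseteq> E" "card (supp M A X) = rank M X" "card (supp M B X) = rank M X"
    using assms(2) by (auto simp: tight_def)
  have finX: "finite X" using X(1) by (rule A.finite_subset_ground)
  have tA: "trank A R X = card (hits A R X)"
    using X A.rank_eq_trank by (simp add: supp_eq_hits)
  have tB: "trank B R X = card (hits B R X)"
    using X B.rank_eq_trank by (simp add: supp_eq_hits)
  have "trank A (R - (I \<union> supp M A X)) Y = trank B (R - (J \<union> supp M B X)) Y" if Y: "Y \<subseteq> E" for Y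
  proof -
    have finY: "finite Y" using Y by (rule A.finite_subset_ground)
    have "trank A (R - I) (Y \<union> X) = trank A (R - I - supp M A X) Y + trank A (R - I) X"
      using trank_contract[OF finX finY _ _ tA, of "R - I"]
        trank_subset_if_full[OF finX _ _ tA, of "R - I"] by (auto simp: supp_eq_hits)
    moreover have "trank B (R - J) (Y \<union> X) = trank B (R - J - supp M B X) Y + trank B (R - J) X"
      using trank_contract[OF finX finY _ _ tB, of "R - J"]
        trank_subset_if_full[OF finX _ _ tB, of "R - J"] by (auto simp: supp_eq_hits)
    moreover have "trank A (R - I) (Y \<union> X) = trank B (R - J) (Y \<union> X)"
      "trank A (R - I) X = trank B (R - J) X"
      using assms(1) X(1) Y by (auto simp: compatible_def)
    ultimately show ?thesis by (simp add: Diff_eq Int_assoc)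
  qed
  then show ?thesis using sub by (simp add: compatible_def supp_subset)
qed

text \<open>In terms of remaining indices, the intersection becomes a union and the assumption on
  the union supplies agreement on the intersection, so \<open>trank_Un_indices_le\<close> applies in
  both directions.\<close>

lemma compatible_Int:
  assumes "compatible I1 J1" "compatible I2 J2" "compatible (I1 \<union> I2) (J1 \<union> J2)"
  shows "compatible (I1 \<inter> I2) (J1 \<inter> J2)"
proof -
  have eqs: "R - (K1 \<inter> K2) = (R - K1) \<union> (R - K2)" "R - (K1 \<union> K2) = (R - K1) \<inter> (R - K2)" for K1 K2
    by auto
  have agree: "trank A (R - I1) V = trank B (R - J1) V" "trank A (R - I2) V = trank B (R - J2) V"
    "trank A ((R - I1) \<inter> (R - I2)) V = trank B ((R - J1) \<inter> (R - J2)) V" if "V \<subseteq> E" for V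
    using assms that unfolding compatible_def eqs by auto
  have "trank A (R - (I1 \<inter> I2)) Y = trank B (R - (J1 \<inter> J2)) Y" if Y: "Y \<subseteq> E" for Y
    unfolding eqs
  proof (rule antisym)
    have V: "V \<subseteq> E" if "V \<subseteq> Y" for V using that Y by blast
    show "trank A ((R - I1) \<union> (R - I2)) Y \<le> trank B ((R - J1) \<union> (R - J2)) Y"
      by (rule trank_Un_indices_le) (simp_all add: A.finite_subset_ground[OF Y] agree V)
    show "trank B ((R - J1) \<union> (R - J2)) Y \<le> trank A ((R - I1) \<union> (R - I2)) Y"
      by (rule trank_Un_indices_le) (simp_all add: A.finite_subset_ground[OF Y] agree V)
  qed
  then show ?thesis using assms by (auto simp: compatible_def)
qed

text \<open>The union needed for \<open>compatible_Int\<close> joins one support to an intersection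
  of supports. This is why \<open>compatible_Un_supp\<close> starts from an arbitrary compatible
  pair.\<close>

lemma compatible_INT_supp:
  assumes "finite \<X>" "\<X> \<noteq> {}" "\<And>X. X \<in> \<X> \<Longrightarrow> tight M A B X"
  shows "compatible (\<Inter>X\<in>\<X>. supp M A X) (\<Inter>X\<in>\<X>. supp M B X)"
  using assms
proof (induction \<X> rule: finite_ne_induct)
  case (singleton X)
  then show ?case using compatible_Un_supp[OF compatible_empty, of X] by simp
next
  case (insert X \<X>)
  have "compatible (supp M A X) (supp M B X)"
    using compatible_Un_supp[OF compatible_empty, of X] insert.prems by simp
  moreover have IH: "compatible (\<Inter>X\<in>\<X>. supp M A X) (\<Inter>X\<in>\<X>. supp M B X)"
    using insert.IH insert.prems by blast
  moreover have "compatible (supp M A X \<union> (\<Inter>X\<in>\<X>. supp M A X)) (supp M B X \<union> (\<Inter>X\<in>\<X>. supp M B X))"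
    using compatible_Un_supp[OF IH, of X] insert.prems by (simp add: Un_commute)
  ultimately show ?case using compatible_Int by simp
qed

section \<open>The common extensions\<close>

lemma tight_indep_both_tight:
  assumes "tight_indep M A Y" "tight_indep M B Y"
  shows "tight M A B Y"
  using assms A.indep_iff_rank[of Y] by (auto simp: tight_def tight_indep_def A.indep_iff)

text \<open>A minimal independent set spanning \<open>x\<close> is tight in either presentation.\<close>

lemma L_common_tight_below:
  assumes "I \<in> L_sets M A x" "J \<in> L_sets M B x" "ext_matroid M A x I = ext_matroid M B x J"
    and "W \<in> indep M" "\<not> avoids M A I W"
  obtains Y where "Y \<subseteq> W" "tight M A B Y" "I \<subseteq> supp M A Y"
proof -
  have sub: "I \<subseteq> R" "J \<subseteq> R" using assms(1,2)[THEN L_sets_subset] by simp_all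
  have iff: "avoids M A I Z \<longleftrightarrow> avoids M B J Z" if "Z \<subseteq> E" for Z
    using assms(3) that unfolding ext_eq_iff[OF sub] by blast
  have WE: "W \<subseteq> E" using assms(4) by (simp add: A.indep_iff)
  let ?F = "{Y. Y \<subseteq> W \<and> \<not> avoids M A I Y}"
  have "finite ?F" using A.finite_subset_ground[OF WE] by simp
  moreover have "W \<in> ?F" using assms(5) by simp
  ultimately have "\<exists>Y\<in>?F. Y \<subseteq> W \<and> (\<forall>Y'\<in>?F. Y' \<subseteq> Y \<longrightarrow> Y = Y')"
    by (rule finite_has_minimal2)
  then obtain Y where Y: "Y \<in> ?F" and min: "\<forall>Y'\<in>?F. Y' \<subseteq> Y \<longrightarrow> Y = Y'"
    by (elim bexE conjE)
  have ind: "Y \<in> indep M" using Y assms(4) matchable_subset[of A R W Y] by (auto simp: A.indep_iff)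
  have below: "avoids M A I Y'" if "Y' \<subset> Y" for Y'
    using bspec[OF min, of Y'] Y that by auto
  \<comment> \<open>The extensions coincide, so minimality of \<open>Y\<close> holds for
    \<open>B\<close> as well and yields tightness there.\<close>
  have belowB: "avoids M B J Y'" if "Y' \<subset> Y" for Y'
    using below[OF that] iff[of Y'] that Y(1) WE by blast
  have "\<not> avoids M B J Y" using iff[of Y] Y(1) WE by blast
  then have "tight_indep M B Y"
    by (rule B.minimal_not_avoiding_tight(1)[OF ind sub(2) _ belowB])
  moreover have "tight_indep M A Y" "I \<subseteq> supp M A Y"
    using A.minimal_not_avoiding_tight[OF ind sub(1) _ below] Y(1) by blast+
  ultimately show thesis using that[of Y] tight_indep_both_tight[of Y] Y by simp
qed

lemma tight_supp_in_L_sets: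
  assumes "tight M A B X"
  shows "supp M A X \<in> L_sets M A x" "supp M B X \<in> L_sets M B x"
  using assms A.supp_in_L_sets[of X] B.supp_in_L_sets[of X] by (auto simp: tight_def)

lemma tight_ext_eq_principal:
  assumes "tight M A B X"
  shows "ext_matroid M A x (supp M A X) = principal_extension M X x"
    "ext_matroid M B x (supp M B X) = principal_extension M X x"
  using assms A.ext_supp_eq_principal_extension[of X] B.ext_supp_eq_principal_extension[of X]
  by (auto simp: tight_def)

lemma tight_principal_in_T_exts:
  assumes "tight M A B X"
  shows "principal_extension M X x \<in> T_exts M A x \<inter> T_exts M B x"
proof -
  have "ext_matroid M D x I \<in> T_exts M D x" if "I \<in> L_sets M D x" for D I
    unfolding T_exts_def using that by blast
  from this[OF tight_supp_in_L_sets(1)[OF assms]] this[OF tight_supp_in_L_sets(2)[OF assms]]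
  show ?thesis by (simp add: tight_ext_eq_principal[OF assms])
qed

text \<open>For a common extension, every tight set separating an index from \<open>I\<close>
  contains a set tight for both presentations, so these already cut out \<open>I\<close>. For the
  converse, the partner index set is the intersection of the matching
  \<open>B\<close>-supports.\<close>

lemma L_common_eq:
  "L_common M A B x = {\<Inter>F | F. F \<noteq> {} \<and> F \<subseteq> {I \<in> L_sets M A x. star M A B I}}"
proof (intro equalityI subsetI)
  fix I assume "I \<in> L_common M A B x"
  then obtain J where IJ: "I \<in> L_sets M A x" "J \<in> L_sets M B x"
      "ext_matroid M A x I = ext_matroid M B x J"
    by (auto simp: L_common_def)
  have sub: "I \<subseteq> R" using IJ(1) by (rule L_sets_subset)
  define F where "F = {supp M A Y | Y. tight M A B Y \<and> I \<subseteq> supp M A Y}"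
  have capture: "\<exists>Y. tight M A B Y \<and> I \<subseteq> supp M A Y \<and> supp M A Y \<subseteq> supp M A W"
    if W: "tight_indep M A W" "I \<subseteq> supp M A W" for W
  proof -
    have "W \<in> indep M" "\<not> avoids M A I W"
      using W A.not_avoids_tight_iff[OF W(1) sub] by (auto simp: tight_indep_def)
    from L_common_tight_below[OF IJ this]
    obtain Y where Y: "Y \<subseteq> W" "tight M A B Y" "I \<subseteq> supp M A Y" .
    then show ?thesis using supp_mono[OF Y(1)] by (intro exI[of _ Y]) simp
  qed
  \<comment> \<open>The whole ground set keeps the family nonempty, also when \<open>I\<close>
    consists of all indices.\<close>
  have "tight M A B E"
    using A.supp_ground B.supp_ground by (simp add: tight_def card_indices)
  then have "F \<noteq> {}" using A.supp_ground sub by (auto simp: F_def)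
  moreover have "F \<subseteq> {I \<in> L_sets M A x. star M A B I}"
    using tight_supp_in_L_sets by (auto simp: F_def star_def)
  moreover have "\<Inter>F = I"
  proof (rule antisym)
    show "I \<subseteq> \<Inter>F" by (auto simp: F_def)
    show "\<Inter>F \<subseteq> I"
    proof
      fix k assume k: "k \<in> \<Inter>F"
      have "k \<in> R" using k \<open>F \<noteq> {}\<close> supp_subset by (fastforce simp: F_def)
      show "k \<in> I"
      proof (rule ccontr)
        assume "k \<notin> I"
        from A.L_sets_separate[OF IJ(1) \<open>k \<in> R\<close> this]
        obtain W where W: "tight_indep M A W" "I \<subseteq> supp M A W" "k \<notin> supp M A W" .
        then obtain Y where "tight M A B Y" "I \<subseteq> supp M A Y" "supp M A Y \<subseteq> supp M A W"
          using capture by blast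
        then show False using k W(3) by (auto simp: F_def)
      qed
    qed
  qed
  ultimately show "I \<in> {\<Inter>F | F. F \<noteq> {} \<and> F \<subseteq> {I \<in> L_sets M A x. star M A B I}}" by blast
next
  fix I assume "I \<in> {\<Inter>F | F. F \<noteq> {} \<and> F \<subseteq> {I \<in> L_sets M A x. star M A B I}}"
  then obtain F where F: "I = \<Inter>F" "F \<noteq> {}" "F \<subseteq> {I \<in> L_sets M A x. star M A B I}" by blast
  \<comment> \<open>Indexing by the sets \<open>X\<close> instead of their \<open>A\<close>-supports
    gives access to the \<open>B\<close>-supports of the same sets.\<close>
  define \<X> where "\<X> = {X. tight M A B X \<and> supp M A X \<in> F}"
  have "\<X> \<subseteq> Pow E" by (auto simp: \<X>_def tight_def)
  then have fin: "finite \<X>" using A.finite_ground finite_subset by blast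
  have FX: "F = supp M A ` \<X>" using F(3) by (auto simp: \<X>_def star_def)
  then have ne: "\<X> \<noteq> {}" using F(2) by blast
  have "compatible (\<Inter>X\<in>\<X>. supp M A X) (\<Inter>X\<in>\<X>. supp M B X)"
    using fin ne by (rule compatible_INT_supp) (simp add: \<X>_def)
  then have "ext_matroid M A x I = ext_matroid M B x (\<Inter>X\<in>\<X>. supp M B X)"
    using compatible_ext_eq F(1) FX by simp
  moreover have "I \<in> L_sets M A x" using A.L_sets_Inter[OF F(2)] F(1,3) by blast
  moreover have "(\<Inter>X\<in>\<X>. supp M B X) \<in> L_sets M B x"
    using ne tight_supp_in_L_sets(2) by (intro B.L_sets_Inter) (auto simp: \<X>_def)
  ultimately show "I \<in> L_common M A B x" by (auto simp: L_common_def)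
qed

text \<open>\<open>avoids\<close> turns a union of index sets into a disjunction, so the two
  equalities of extensions combine.\<close>

lemma L_common_Un:
  assumes "I1 \<in> L_common M A B x" "I2 \<in> L_common M A B x"
  shows "I1 \<union> I2 \<in> L_common M A B x"
proof -
  obtain J1 where 1: "I1 \<in> L_sets M A x" "J1 \<in> L_sets M B x"
      "ext_matroid M A x I1 = ext_matroid M B x J1"
    using assms(1) by (auto simp: L_common_def)
  obtain J2 where 2: "I2 \<in> L_sets M A x" "J2 \<in> L_sets M B x"
      "ext_matroid M A x I2 = ext_matroid M B x J2"
    using assms(2) by (auto simp: L_common_def)
  have sub: "I1 \<subseteq> R" "J1 \<subseteq> R" "I2 \<subseteq> R" "J2 \<subseteq> R" 
    using 1(1,2)[THEN L_sets_subset] 2(1,2)[THEN L_sets_subset] by simp_all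
  have Un: "avoids M D (K1 \<union> K2) Z \<longleftrightarrow> avoids M D K1 Z \<or> avoids M D K2 Z" for D K1 K2 Z
    by (auto simp: avoids_def)
  have "ext_matroid M A x (I1 \<union> I2) = ext_matroid M B x (J1 \<union> J2)"
    using 1(3) 2(3) sub ext_eq_iff[of I1 J1] ext_eq_iff[of I2 J2]
    by (subst ext_eq_iff) (auto simp: Un)
  then show ?thesis
    using A.L_sets_Un[OF 1(1) 2(1)] B.L_sets_Un[OF 1(2) 2(2)] by (auto simp: L_common_def)
qed

text \<open>By \<open>L_common_eq\<close> it suffices to merge the two families of sets satisfying
  \<open>star\<close>.\<close>

lemma L_common_Int:
  assumes "I1 \<in> L_common M A B x" "I2 \<in> L_common M A B x"
  shows "I1 \<inter> I2 \<in> L_common M A B x"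
proof -
  obtain F G where FG: "I1 = \<Inter>F" "F \<noteq> {}" "F \<subseteq> {I \<in> L_sets M A x. star M A B I}"
      "I2 = \<Inter>G" "G \<noteq> {}" "G \<subseteq> {I \<in> L_sets M A x. star M A B I}"
    using assms unfolding L_common_eq by blast
  then have "I1 \<inter> I2 = \<Inter>(F \<union> G)" "F \<union> G \<noteq> {}" "F \<union> G \<subseteq> {I \<in> L_sets M A x. star M A B I}"
    by auto
  then show ?thesis unfolding L_common_eq by blast
qed

text \<open>A basis of \<open>Y\<close> spans \<open>x\<close> and so contains a set
  \<open>X\<close> tight for both whose support includes \<open>I\<close>. Conversely a tight set
  whose support includes \<open>I\<close> spans \<open>x\<close>, hence \<open>Y\<close> and
  \<open>X\<close>, so its support contains that of \<open>X\<close>; no index outside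
  \<open>I\<close> survives.\<close>

lemma star_if_principal:
  assumes "I \<in> L_sets M A x" "J \<in> L_sets M B x" "ext_matroid M A x I = ext_matroid M B x J"
    and "Y \<subseteq> E" "ext_matroid M A x I = principal_extension M Y x"
  shows "star M A B I"
proof -
  have sub: "I \<subseteq> R" using assms(1) by (rule L_sets_subset)
  have iff: "avoids M A I Z \<longleftrightarrow> Z \<in> indep M \<and> \<not> Y \<subseteq> closure M Z" if "Z \<subseteq> E" for Z
    using assms(5) that unfolding A.ext_eq_principal_iff[OF sub] by blast
  obtain W where W: "W \<subseteq> Y" "matchable A R W" "card W = trank A R Y"
    using trank_basis[OF A.finite_subset_ground[OF assms(4)] finite_indices] .
  have WE: "W \<subseteq> E" using W(1) assms(4) by blast
  have ind: "W \<in> indep M" using W(2) WE by (simp add: A.indep_iff)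
  have "rank M (W \<union> Y) = rank M W"
    using W assms(4) WE ind A.indep_iff_rank[OF WE] A.rank_eq_trank[OF assms(4)]
    by (simp add: Un_absorb1)
  then have "\<not> avoids M A I W"
    using iff[OF WE] A.subset_closure_iff[OF assms(4) WE] by blast
  from L_common_tight_below[OF assms(1-3) ind this]
  obtain X where X: "X \<subseteq> W" "tight M A B X" "I \<subseteq> supp M A X" .
  have XE: "X \<subseteq> E" "X \<subseteq> Y" using X(1) WE W(1) by auto
  have "supp M A X \<subseteq> I"
  proof
    fix k assume k: "k \<in> supp M A X"
    show "k \<in> I"
    proof (rule ccontr)
      assume "k \<notin> I"
      from A.L_sets_separate[OF assms(1) subsetD[OF supp_subset k] this]
      obtain V where V: "tight_indep M A V" "I \<subseteq> supp M A V" "k \<notin> supp M A V" .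
      have VE: "V \<subseteq> E" "V \<in> indep M" using V(1) by (auto simp: tight_indep_def A.indep_iff)
      have "Y \<subseteq> closure M V"
        using iff[OF VE(1)] VE(2) A.not_avoids_tight_iff[OF V(1) sub] V(2) by blast
      then have "X \<subseteq> closure M V" using XE(2) by blast
      then have "rank M (V \<union> X) = rank M V" using A.subset_closure_iff[OF XE(1) VE(1)] by blast
      then show False using A.supp_subset_if_rank_Un[OF V(1) XE(1)] k V(3) by blast
    qed
  qed
  then show ?thesis using X(2,3) by (auto simp: star_def)
qed

lemma bij_betw_star_principal:
  "bij_betw (ext_matroid M A x) {I \<in> L_sets M A x. star M A B I}
    {N \<in> T_exts M A x \<inter> T_exts M B x. \<exists>Y\<subseteq>E. N = principal_extension M Y x}"
  unfolding bij_betw_def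
proof (intro conjI equalityI subsetI)
  show "inj_on (ext_matroid M A x) {I \<in> L_sets M A x. star M A B I}"
    by (rule inj_on_subset[OF A.inj_on_ext_matroid]) auto
next
  fix N assume "N \<in> ext_matroid M A x ` {I \<in> L_sets M A x. star M A B I}"
  then obtain I where I: "star M A B I" "N = ext_matroid M A x I" by blast
  then obtain X where X: "tight M A B X" "N = ext_matroid M A x (supp M A X)"
    unfolding star_def by (elim exE conjE) simp
  then have "N = principal_extension M X x" using tight_ext_eq_principal(1) by simp
  then show "N \<in> {N \<in> T_exts M A x \<inter> T_exts M B x. \<exists>Y\<subseteq>E. N = principal_extension M Y x}"
    using tight_principal_in_T_exts[OF X(1)] X(1) unfolding tight_def by blast
next
  fix N assume "N \<in> {N \<in> T_exts M A x \<inter> T_exts M B x. \<exists>Y\<subseteq>E. N = principal_extension M Y x}"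
  then have "N \<in> T_exts M A x" "N \<in> T_exts M B x" "\<exists>Y\<subseteq>E. N = principal_extension M Y x"
    by simp_all
  then obtain I J Y where N: "I \<in> L_sets M A x" "J \<in> L_sets M B x" "N = ext_matroid M A x I"
      "N = ext_matroid M B x J" "Y \<subseteq> E" "N = principal_extension M Y x"
    unfolding T_exts_def mem_Collect_eq by (elim exE conjE)
  have "star M A B I"
    by (rule star_if_principal[OF N(1,2) _ N(5)]) (simp_all flip: N(3,4,6))
  then have "I \<in> {I \<in> L_sets M A x. star M A B I}" using N(1) by simp
  then show "N \<in> ext_matroid M A x ` {I \<in> L_sets M A x. star M A B I}"
    unfolding N(3) by (rule imageI)
qed

end

theorem theorem3p16:
  fixes M :: "'a matroid" and A B :: "nat \<Rightarrow> 'a set" and x :: 'a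
  assumes "finite (ground M)"
    and "presentation M A" and "presentation M B"
    and "x \<notin> ground M"
  shows "L_common M A B x \<subseteq> L_sets M A x \<and>
    (\<forall>I \<in> L_common M A B x. \<forall>J \<in> L_common M A B x.
       I \<inter> J \<in> L_common M A B x \<and> I \<union> J \<in> L_common M A B x) \<and>
    L_common M A B x =
      {\<Inter>F | F. F \<noteq> {} \<and> F \<subseteq> {I \<in> L_sets M A x. star M A B I}} \<and>
    (\<forall>X. tight M A B X \<longrightarrow>
       ext_matroid M A x (supp M A X) = principal_extension M X x \<and>
       ext_matroid M B x (supp M B X) = principal_extension M X x \<and>
       principal_extension M X x \<in> T_exts M A x \<inter> T_exts M B x) \<and>
    bij_betw (ext_matroid M A x) {I \<in> L_sets M A x. star M A B I}
      {N \<in> T_exts M A x \<inter> T_exts M B x. \<exists>Y \<subseteq> ground M. N = principal_extension M Y x}"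
proof -
  interpret two_presentations M A B x
    using assms by unfold_locales
  have "L_common M A B x \<subseteq> L_sets M A x" by (auto simp: L_common_def)
  then show ?thesis
    by (intro conjI ballI allI impI L_common_Int L_common_Un L_common_eq bij_betw_star_principal
        tight_ext_eq_principal tight_principal_in_T_exts)
qed

end
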